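(* Let $U\subseteq\mathbb{R}^n$ be open and let $X$ be a smooth vector field on $U$ such that $\dot x=X(x)$ is a codimension-one dissipative dynamical system, i.e. there exist $k,p\in\mathbb{N}$ with $p>0$ and $k+p=n-1$, and functions $I_1,\dots,I_k,D_1,\dots,D_p,h_1,\dots,h_p\in C^\infty(U,\mathbb{R})$ such that $$\mathcal{L}_XI_1=\dots=\mathcal{L}_XI_k=0,\qquad \mathcal{L}_XD_1=h_1D_1,\ \dots,\ \mathcal{L}_XD_p=h_pD_p .$$ Suppose that $\Gamma=\{\gamma(t)\in U:0\le t\le T\}$ is a $T$-periodic orbit of $\dot x=X(x)$ such that: (i) $\Gamma\subset ID^{-1}(\{0\})$, and $0\in\mathbb{R}^{n-1}$ is a regular value of the map $ID=(I_1,\dots,I_k,D_1,\dots,D_p):U\to\mathbb{R}^{n-1}$; (ii) the vectors $\nabla I_1(\gamma(t)),\dots,\nabla I_k(\gamma(t)),\nabla D_1(\gamma(t)),\dots,\nabla D_p(\gamma(t)),X(\gamma(t))$ are linearly independent for each $0\le t\le T$. Then: (a) if moreover $0\in\mathbb{R}^k$ is a regular value of the map $I=(I_1,\dots,I_k):U\to\mathbb{R}^k$, and if $$\int_0^Th_1(\gamma(s))\,ds<0,\ \dots,\ \int_0^Th_p(\gamma(s))\,ds<0,$$ then the periodic orbit $\Gamma$ is orbitally phase asymptotically stable with respect to perturbations along the invariant manifold $I^{-1}(\{0\})$; (b) on the other hand, if there exists $i_0\in\{1,\dots,p\}$ such that $\int_0^Th_{i_0}(\gamma(s))\,ds>0$,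 then the periodic orbit $\Gamma$ is unstable.
   Context: $\mathbb{N}$ includes $0$. $\mathcal{L}_X f=\langle X,\nabla f\rangle$ is the Lie derivative of a smooth function $f$ along $X$, where $\langle\cdot,\cdot\rangle$ is the standard inner product on $\mathbb{R}^n$ and $\nabla$ the corresponding gradient. Stability notions for a periodic orbit $\Gamma=\{\gamma(t):0\le t\le T\}$ of $\dot x=X(x)$ on $U$ (here $x(t,x_0)$ denotes the solution with $x(0,x_0)=x_0$, and $\operatorname{dist}$ is the distance from a point to a set): - $\Gamma$ is orbitally stable if for every $\varepsilon>0$ there is $\delta>0$ such that $\operatorname{dist}(x(t,x_0),\Gamma)<\varepsilon$ for all $t>0$ and all $x_0\in U$ with $\operatorname{dist}(x_0,\Gamma)<\delta$. - $\Gamma$ is unstable if it is not orbitally stable. - $\Gamma$ is orbitally asymptotically stable if it is orbitally stable and (choosing $\delta$ smaller if necessary) $\operatorname{dist}(x(t,x_0),\Gamma)\to0$ as $t\to\infty$ for all $x_0\in U$ with $\operatorname{dist}(x_0,\Gamma)<\delta$. - $\Gamma$ is orbitally phase asymptotically stable if it is orbitally asymptotically stable and there is $\delta>0$ such that for each $x_0\in U$ with $\operatorname{dist}(x_0,\Gamma)<\delta$ there exists $\theta_0=\theta_0(x_0)$ with $\lim_{t\to\infty}\|x(t,x_0)-\gamma(t+\theta_0)\|=0$. "Orbitally phase asymptotically stable with respect to perturbations along the invariant manifold $I^{-1}(\{0\})$" means that $\Gamma$, as a periodic orbit of the restriction of the vector field to the dynamically invariant manifold $I^{-1}(\{0\})$,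 is orbitally phase asymptotically stable, i.e. for every $\varepsilon>0$ there is $\delta>0$ such that $\operatorname{dist}(x(t,x_0),\Gamma)<\varepsilon$ for all $t>0$ and all $x_0\in I^{-1}(\{0\})$ with $\operatorname{dist}(x_0,\Gamma)<\delta$, and there is $\delta>0$ such that for each $x_0\in I^{-1}(\{0\})$ with $\operatorname{dist}(x_0,\Gamma)<\delta$ one has $\operatorname{dist}(x(t,x_0),\Gamma)\to0$ as $t\to\infty$ and there exists $\theta_0=\theta_0(x_0)$ with $\lim_{t\to\infty}\|x(t,x_0)-\gamma(t+\theta_0)\|=0$. (If $k=0$, then $I^{-1}(\{0\})$ is all of $U$.) *)

theory Defs
  imports "HOL-Analysis.Analysis"
begin

text \<open>\<open>Ck_on m f U\<close>, for open \<open>U\<close>: \<open>f\<close> is of class \<open>C\<^sup>m\<close> on \<open>U\<close>, i.e. all iterated directional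
  derivatives of order at most \<open>m\<close> exist (as Frechet derivatives) and are continuous.\<close>

primrec Ck_on ::
    "nat \<Rightarrow> ('a::real_normed_vector \<Rightarrow> 'b::real_normed_vector) \<Rightarrow> 'a set \<Rightarrow> bool" where
  "Ck_on 0 f U \<longleftrightarrow> continuous_on U f"
| "Ck_on (Suc m) f U \<longleftrightarrow>
     (\<forall>x\<in>U. f differentiable (at x)) \<and>
     (\<forall>v. Ck_on m (\<lambda>x. frechet_derivative f (at x) v) U)"

definition smooth_on ::
    "'a set \<Rightarrow> ('a::real_normed_vector \<Rightarrow> 'b::real_normed_vector) \<Rightarrow> bool" where
  "smooth_on U f \<longleftrightarrow> (\<forall>m. Ck_on m f U)"

definition gradient :: "('a::real_inner \<Rightarrow> real) \<Rightarrow> 'a \<Rightarrow> 'a" where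
  "gradient f x = (THE g. GDERIV f x :> g)"

definition lie_derivative :: "('a::real_inner \<Rightarrow> 'a) \<Rightarrow> ('a \<Rightarrow> real) \<Rightarrow> 'a \<Rightarrow> real" where
  "lie_derivative X f x = X x \<bullet> gradient f x"

text \<open>A map \<open>F = (F 0, \<dots>, F (m-1)) : U \<rightarrow> \<real>\<^sup>m\<close> is given by its components, so that \<open>m = 0\<close> is
  allowed; only the values \<open>c i\<close> with \<open>i < m\<close> matter for a point \<open>c\<close> of \<open>\<real>\<^sup>m\<close>. A regular value is
  one over which the differential of \<open>F\<close> is everywhere onto \<open>\<real>\<^sup>m\<close>.\<close>

definition regular_value ::
    "'a::real_normed_vector set \<Rightarrow> nat \<Rightarrow> (nat \<Rightarrow> 'a \<Rightarrow> real) \<Rightarrow> (nat \<Rightarrow> real) \<Rightarrow> bool" where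
  "regular_value U m F c \<longleftrightarrow>
     (\<forall>x\<in>U. (\<forall>i<m. F i x = c i) \<longrightarrow>
        (\<forall>y::nat \<Rightarrow> real. \<exists>v. \<forall>i<m. frechet_derivative (F i) (at x) v = y i))"

definition zero_fibre :: "'a set \<Rightarrow> nat \<Rightarrow> (nat \<Rightarrow> 'a \<Rightarrow> real) \<Rightarrow> 'a set" where
  "zero_fibre U m F = {x \<in> U. \<forall>i<m. F i x = 0}"

text \<open>The joint map \<open>ID = (I\<^sub>1, \<dots>, I\<^sub>k, D\<^sub>1, \<dots>, D\<^sub>p)\<close>; components are numbered from \<open>0\<close>.\<close>

definition join_maps ::
    "nat \<Rightarrow> (nat \<Rightarrow> 'a \<Rightarrow> real) \<Rightarrow> (nat \<Rightarrow> 'a \<Rightarrow> real) \<Rightarrow> nat \<Rightarrow> 'a \<Rightarrow> real" where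
  "join_maps k I D i = (if i < k then I i else D (i - k))"

definition codim_one_dissipative ::
    "(real ^ 'n) set \<Rightarrow> (real ^ 'n \<Rightarrow> real ^ 'n) \<Rightarrow> nat \<Rightarrow> nat \<Rightarrow>
     (nat \<Rightarrow> real ^ 'n \<Rightarrow> real) \<Rightarrow> (nat \<Rightarrow> real ^ 'n \<Rightarrow> real) \<Rightarrow> (nat \<Rightarrow> real ^ 'n \<Rightarrow> real) \<Rightarrow> bool" where
  "codim_one_dissipative U X k p I D h \<longleftrightarrow>
     p > 0 \<and> k + p = CARD('n) - 1 \<and>
     (\<forall>i<k. smooth_on U (I i) \<and> (\<forall>x\<in>U. lie_derivative X (I i) x = 0)) \<and>
     (\<forall>j<p. smooth_on U (D j) \<and> smooth_on U (h j) \<and>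
            (\<forall>x\<in>U. lie_derivative X (D j) x = h j x * D j x))"

definition solution_on ::
    "'a::real_normed_vector set \<Rightarrow> ('a \<Rightarrow> 'a) \<Rightarrow> real set \<Rightarrow> (real \<Rightarrow> 'a) \<Rightarrow> bool" where
  "solution_on U X J x \<longleftrightarrow>
     (\<forall>t\<in>J. x t \<in> U \<and> (x has_vector_derivative X (x t)) (at t within J))"

definition T_periodic_solution ::
    "'a::real_normed_vector set \<Rightarrow> ('a \<Rightarrow> 'a) \<Rightarrow> real \<Rightarrow> (real \<Rightarrow> 'a) \<Rightarrow> bool" where
  "T_periodic_solution U X T \<gamma> \<longleftrightarrow>
     T > 0 \<and> solution_on U X UNIV \<gamma> \<and> (\<forall>t. \<gamma> (t + T) = \<gamma> t)"

text \<open>\<open>forward_solution U X x0 x\<close>: \<open>x\<close> is the solution \<open>x(\<cdot>, x0)\<close>, and it exists for all times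
  \<open>t \<ge> 0\<close>. For smooth \<open>X\<close> there is, on \<open>[0, \<infinity>)\<close>, at most one such \<open>x\<close>, so below \<open>\<exists>x\<close> only
  expresses that \<open>x(t, x0)\<close> is defined for all \<open>t \<ge> 0\<close>.\<close>

definition forward_solution ::
    "'a::real_normed_vector set \<Rightarrow> ('a \<Rightarrow> 'a) \<Rightarrow> 'a \<Rightarrow> (real \<Rightarrow> 'a) \<Rightarrow> bool" where
  "forward_solution U X x0 x \<longleftrightarrow> solution_on U X {0..} x \<and> x 0 = x0"

text \<open>In the stability notions the set \<open>M \<subseteq> U\<close> collects the admissible initial points: \<open>M = U\<close>
  gives the plain notions, an invariant set \<open>M\<close> gives stability with respect to perturbations
  along \<open>M\<close>.\<close>

definition orbitally_stable ::
    "'a::real_normed_vector set \<Rightarrow> ('a \<Rightarrow> 'a) \<Rightarrow> 'a set \<Rightarrow> 'a set \<Rightarrow> bool" where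
  "orbitally_stable U X M \<Gamma> \<longleftrightarrow>
     (\<forall>\<epsilon>>0. \<exists>\<delta>>0. \<forall>x0\<in>M. infdist x0 \<Gamma> < \<delta> \<longrightarrow>
        (\<exists>x. forward_solution U X x0 x \<and> (\<forall>t>0. infdist (x t) \<Gamma> < \<epsilon>)))"

definition orbitally_asymptotically_stable ::
    "'a::real_normed_vector set \<Rightarrow> ('a \<Rightarrow> 'a) \<Rightarrow> 'a set \<Rightarrow> 'a set \<Rightarrow> bool" where
  "orbitally_asymptotically_stable U X M \<Gamma> \<longleftrightarrow>
     orbitally_stable U X M \<Gamma> \<and>
     (\<exists>\<delta>>0. \<forall>x0\<in>M. infdist x0 \<Gamma> < \<delta> \<longrightarrow>
        (\<exists>x. forward_solution U X x0 x \<and> ((\<lambda>t. infdist (x t) \<Gamma>) \<longlongrightarrow> 0) at_top))"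

definition orbitally_phase_asymptotically_stable ::
    "'a::real_normed_vector set \<Rightarrow> ('a \<Rightarrow> 'a) \<Rightarrow> 'a set \<Rightarrow> real \<Rightarrow> (real \<Rightarrow> 'a) \<Rightarrow> bool" where
  "orbitally_phase_asymptotically_stable U X M T \<gamma> \<longleftrightarrow>
     orbitally_asymptotically_stable U X M (\<gamma> ` {0..T}) \<and>
     (\<exists>\<delta>>0. \<forall>x0\<in>M. infdist x0 (\<gamma> ` {0..T}) < \<delta> \<longrightarrow>
        (\<exists>x. forward_solution U X x0 x \<and>
             (\<exists>\<theta>0. ((\<lambda>t. norm (x t - \<gamma> (t + \<theta>0))) \<longlongrightarrow> 0) at_top)))"

definition orbitally_unstable ::
    "'a::real_normed_vector set \<Rightarrow> ('a \<Rightarrow> 'a) \<Rightarrow> 'a set \<Rightarrow> bool" where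
  "orbitally_unstable U X \<Gamma> \<longleftrightarrow> \<not> orbitally_stable U X U \<Gamma>"

text \<open>Linear independence of a finite family, so repetitions count as dependence.\<close>

definition independent_family :: "'a::real_vector list \<Rightarrow> bool" where
  "independent_family vs \<longleftrightarrow> distinct vs \<and> independent (set vs)"

end

theory Submission
  imports Defs
begin

text \<open>
  Both parts are read off one period at a time, with neither a Poincare map nor Floquet theory.

  As \<open>\<L>\<^sub>X D = h D\<close>, along a solution \<open>x\<close> the value \<open>D (x t)\<close> solves a scalar linear equation with
  coefficient \<open>h (x t)\<close>. If \<open>x\<close> starts close enough to \<open>\<Gamma>\<close>, then by Gronwall's inequality it stays
  close to \<open>\<gamma> (\<theta> + \<cdot>)\<close> for one period, for a suitable phase \<open>\<theta>\<close> (lemma \<open>shadowing\<close>), and over that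
  period \<open>D\<close> is multiplied by approximately \<open>exp (\<integral>\<^sub>0\<^sup>T h (\<gamma> s) ds)\<close> (lemma \<open>multiplier_bounds\<close>).

  Part (b): let the integral of \<open>h\<^sub>j\<close> be positive. If \<open>\<Gamma>\<close> were stable, a solution starting near \<open>\<Gamma>\<close>
  with \<open>D\<^sub>j \<noteq> 0\<close> would remain near \<open>\<Gamma>\<close>, where \<open>D\<^sub>j\<close> is bounded, although \<open>\<bar>D\<^sub>j\<bar>\<close> grows by a fixed factor
  greater than \<open>1\<close> in every period (lemma \<open>unstable_of_expansion\<close>). Such starting points exist because
  \<open>\<nabla>D\<^sub>j\<close> does not vanish on \<open>\<Gamma>\<close>.

  Part (a): all integrals are negative, so \<open>V = \<Sum>\<^sub>j \<bar>D\<^sub>j\<bar>\<close> is multiplied by at most some \<open>q < 1\<close> in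
  every period. On \<open>I\<^sup>-\<^sup>1 {0}\<close> near \<open>\<Gamma>\<close> the function \<open>V\<close> is comparable with the distance to \<open>\<Gamma>\<close>: if \<open>y \<in> \<Gamma>\<close> is
  nearest to \<open>x\<close>, then \<open>x - y\<close> is orthogonal to \<open>X y\<close>, and by the independence of the gradients
  together with \<open>X y\<close> such a displacement is seen by \<open>(I, D)\<close> to first order
  (lemma \<open>transversal_distance_estimate\<close>). Hence the distance to \<open>\<Gamma>\<close> at the times \<open>n T\<close> is at most
  \<open>const \<cdot> q\<^sup>n\<close>. The nearest point \<open>y\<close> returns to itself after one period, so \<open>x (n T)\<close> moves by at most
  \<open>const \<cdot> q\<^sup>n\<close> between \<open>n T\<close> and \<open>(n + 1) T\<close>. These displacements are summable: the points \<open>x (n T)\<close> never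
  leave the neighbourhood of their starting point, which gives stability, and they converge, to a
  point \<open>\<gamma> \<psi>\<close> of \<open>\<Gamma>\<close>. This \<open>\<psi>\<close> is the asymptotic phase, since by Gronwall's inequality \<open>x t\<close> follows
  \<open>\<gamma> (\<psi> + t)\<close> over each period better and better
  (lemma \<open>phase_asymptotically_stable_of_contraction\<close>).

  Solutions that exist for all positive times are obtained without continuation arguments: the
  difference to \<open>\<gamma> (\<theta> + \<cdot>)\<close> solves an equation whose right hand side is cut off outside a tube around
  the orbit and is then globally Lipschitz (lemma \<open>cutoff_solution\<close>), and the estimates above show
  that the solution never reaches the boundary of the tube.
\<close>

section \<open>Functions of class \<open>C\<^sup>1\<close> near a compact set\<close>

lemma norm_linear_le_sum_Basis:
  fixes l :: "'a::euclidean_space \<Rightarrow> 'b::real_normed_vector"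
  assumes "linear l"
  shows "norm (l v) \<le> (\<Sum>b\<in>Basis. norm (l b)) * norm v"
proof -
  have "l v = l (\<Sum>b\<in>Basis. (v \<bullet> b) *\<^sub>R b)"
    by (simp add: euclidean_representation)
  also have "\<dots> = (\<Sum>b\<in>Basis. (v \<bullet> b) *\<^sub>R l b)"
    by (simp add: linear_sum[OF assms] linear_scale[OF assms])
  also have "norm \<dots> \<le> (\<Sum>b\<in>Basis. norm (l b) * norm v)"
    by (rule sum_norm_le) (metis Basis_le_norm mult.commute mult_right_mono norm_ge_zero norm_scaleR)
  finally show ?thesis by (simp add: sum_distrib_right)
qed

lemma compact_neighbourhood_tube:
  fixes G :: "'a::euclidean_space set"
  assumes "open U" "compact G" "G \<noteq> {}" "G \<subseteq> U"
  obtains R K where "R > 0" "compact K" "K \<subseteq> U" "\<And>y. y \<in> G \<Longrightarrow> cball y R \<subseteq> K"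
proof -
  obtain R where R: "R > 0" "(\<Union>y\<in>G. cball y R) \<subseteq> U"
    using compact_subset_open_imp_cball_epsilon_subset[OF assms(2,1,4)] by metis
  let ?K = "{x. infdist x G \<le> R}"
  have "compact ?K" using assms R by (simp add: compact_infdist_le)
  moreover have "?K \<subseteq> U"
  proof
    fix x assume "x \<in> ?K"
    moreover obtain y where "y \<in> G" "infdist x G = dist x y"
      using infdist_attains_inf[of G x] assms compact_imp_closed by metis
    ultimately show "x \<in> U" using R by (fastforce simp: dist_commute)
  qed
  moreover have "cball y R \<subseteq> ?K" if "y \<in> G" for y
    using that by (auto simp: dist_commute intro: infdist_le2)
  ultimately show ?thesis using that R by blast
qed

text \<open>Finitely many smallness conditions on the radius of a tube have to hold at once; phrased with the
filter \<open>at_right 0\<close> they can be intersected without computing minima.\<close>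

lemma eventually_at_right_downward:
  fixes R :: real
  assumes "R > 0" "P R" "\<And>r r'. 0 < r' \<Longrightarrow> r' \<le> r \<Longrightarrow> P r \<Longrightarrow> P r'"
  shows "\<forall>\<^sub>F r in at_right 0. P r"
  using assms unfolding eventually_at_right_field by (metis less_eq_real_def)

text \<open>The derivative is uniformly continuous on a compact neighbourhood of \<open>G\<close>, which makes the error of
the linear approximation uniform over the base points in \<open>G\<close>.\<close>

lemma C1_uniform_linearization:
  fixes f :: "'a::euclidean_space \<Rightarrow> 'b::real_normed_vector"
  assumes "open U" "compact G" "G \<noteq> {}" "G \<subseteq> U" "Ck_on (Suc 0) f U" "e > 0"
  shows "\<forall>\<^sub>F r in at_right 0. \<forall>y\<in>G. \<forall>x\<in>cball y r.
           norm (f x - f y - frechet_derivative f (at y) (x - y)) \<le> e * norm (x - y)"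
proof -
  let ?f' = "\<lambda>x. frechet_derivative f (at x)"
  obtain R K where K: "R > 0" "compact K" "K \<subseteq> U" "\<And>y. y \<in> G \<Longrightarrow> cball y R \<subseteq> K"
    using compact_neighbourhood_tube assms by metis
  have der: "(f has_derivative ?f' x) (at x)" if "x \<in> U" for x
    using assms(5) that frechet_derivative_works by auto
  define e' where "e' = e / DIM('a)"
  have "e' > 0" using assms by (simp add: e'_def)
  have "\<forall>\<^sub>F d in at_right 0. \<forall>x\<in>K. \<forall>y\<in>K. dist x y < d \<longrightarrow> norm (?f' x b - ?f' y b) < e'" for b
  proof -
    have "uniformly_continuous_on K (\<lambda>x. ?f' x b)"
      using assms(5) K by (intro compact_uniformly_continuous) (auto intro: continuous_on_subset)
    then obtain d where "d > 0" "\<forall>x\<in>K. \<forall>y\<in>K. dist y x < d \<longrightarrow> dist (?f' y b) (?f' x b) < e'"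
      unfolding uniformly_continuous_on_def using \<open>e' > 0\<close> by metis
    then show ?thesis
      by (intro eventually_at_right_downward[of d]) (auto simp: dist_norm)
  qed
  then have "\<forall>\<^sub>F d in at_right 0. \<forall>b\<in>Basis. \<forall>x\<in>K. \<forall>y\<in>K. dist x y < d \<longrightarrow> norm (?f' x b - ?f' y b) < e'"
    by (simp add: eventually_ball_finite_distrib)
  moreover have "\<forall>\<^sub>F d in at_right 0. d < R"
    using K by (simp add: eventually_at_right_field) metis
  moreover have "\<forall>\<^sub>F d in at_right 0. (0::real) < d" by (simp add: eventually_at_right_less)
  ultimately have "\<forall>\<^sub>F d in at_right 0. 0 < d \<and> d < R \<and>
      (\<forall>b\<in>Basis. \<forall>x\<in>K. \<forall>y\<in>K. dist x y < d \<longrightarrow> norm (?f' x b - ?f' y b) < e')"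
    by eventually_elim auto
  from eventually_happens'[OF trivial_limit_at_right_real this] obtain d where d: "0 < d" "d < R"
    "\<And>b x y. b \<in> Basis \<Longrightarrow> x \<in> K \<Longrightarrow> y \<in> K \<Longrightarrow> dist x y < d \<Longrightarrow> norm (?f' x b - ?f' y b) < e'"
    by auto
  show ?thesis
  proof (rule eventually_at_right_downward[of "d/2"])
    show "\<forall>y\<in>G. \<forall>x\<in>cball y (d/2). norm (f x - f y - ?f' y (x - y)) \<le> e * norm (x - y)"
    proof (intro ballI)
      fix y x assume y: "y \<in> G" and x: "x \<in> cball y (d/2)"
      have sub: "cball y (d/2) \<subseteq> K" using K(4)[OF y] d by auto
      have on: "onorm (?f' z - ?f' y) \<le> e" if z: "z \<in> cball y (d/2)" for z
      proof (rule onorm_le)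
        fix v
        have yK: "y \<in> K" "z \<in> K" using sub z d by auto
        have "linear (\<lambda>v. ?f' z v - ?f' y v)"
          using yK K der by (intro linear_compose_sub has_derivative_linear[of f]) auto
        then have "norm (?f' z v - ?f' y v) \<le> (\<Sum>b\<in>Basis. norm (?f' z b - ?f' y b)) * norm v"
          using norm_linear_le_sum_Basis[of "\<lambda>v. ?f' z v - ?f' y v" v] by simp
        also have "(\<Sum>b\<in>Basis. norm (?f' z b - ?f' y b)) \<le> (\<Sum>b\<in>(Basis::'a set). e')"
        proof (rule sum_mono)
          fix b :: 'a assume "b \<in> Basis"
          moreover have "dist z y < d" using z d by (simp add: dist_commute)
          ultimately show "norm (?f' z b - ?f' y b) \<le> e'" using yK d(3) less_imp_le by metis
        qed
        also have "\<dots> = e" by (simp add: e'_def)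
        finally show "norm ((?f' z - ?f' y) v) \<le> e * norm v" by (simp add: mult_right_mono)
      qed
      have "norm (f x - f y - ?f' y (x - y)) \<le> norm (x - y) * e"
      proof (rule differentiable_bound_linearization)
        show "y + t *\<^sub>R (x - y) \<in> cball y (d/2)" if "t \<in> {0..1}" for t
          using convexD_alt[OF convex_cball, of y y "d/2" x t] x d that by (simp add: algebra_simps)
        show "(f has_derivative ?f' z) (at z within cball y (d/2))" if "z \<in> cball y (d/2)" for z
          using der that sub K has_derivative_at_withinI by blast
      qed (use on d in auto)
      then show "norm (f x - f y - ?f' y (x - y)) \<le> e * norm (x - y)" by (simp add: mult.commute)
    qed
  next
    fix r r' :: real assume "r' \<le> r"
      "\<forall>y\<in>G. \<forall>x\<in>cball y r. norm (f x - f y - ?f' y (x - y)) \<le> e * norm (x - y)"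
    then show "\<forall>y\<in>G. \<forall>x\<in>cball y r'. norm (f x - f y - ?f' y (x - y)) \<le> e * norm (x - y)"
      by auto
  qed (use d in simp)
qed

text \<open>The Lipschitz condition is asked for on balls only: these are convex, so a bound on the derivative
suffices, and every use below compares points lying in one ball around a point of \<open>G\<close>.\<close>

lemma C1_lipschitz_tube:
  fixes f :: "'a::euclidean_space \<Rightarrow> 'b::real_normed_vector"
  assumes "open U" "compact G" "G \<noteq> {}" "G \<subseteq> U" "Ck_on (Suc 0) f U"
  obtains L where "L > 0" "\<forall>\<^sub>F r in at_right 0. \<forall>y\<in>G. cball y r \<subseteq> U \<and> L-lipschitz_on (cball y r) f"
proof -
  let ?f' = "\<lambda>x. frechet_derivative f (at x)"
  obtain R K where K: "R > 0" "compact K" "K \<subseteq> U" "\<And>y. y \<in> G \<Longrightarrow> cball y R \<subseteq> K"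
    using compact_neighbourhood_tube assms by metis
  have der: "(f has_derivative ?f' x) (at x)" if "x \<in> U" for x
    using assms(5) that frechet_derivative_works by auto
  have "continuous_on K (\<lambda>x. \<Sum>b\<in>Basis. norm (?f' x b))"
    using assms(5) K by (intro continuous_intros) (auto intro: continuous_on_subset)
  then have "bounded ((\<lambda>x. \<Sum>b\<in>Basis. norm (?f' x b)) ` K)"
    using K by (intro compact_imp_bounded compact_continuous_image)
  then obtain L where L: "L > 0" "\<And>x. x \<in> K \<Longrightarrow> (\<Sum>b\<in>Basis. norm (?f' x b)) \<le> L"
    unfolding bounded_pos by (metis abs_le_D1 image_eqI real_norm_def)
  have "L-lipschitz_on (cball y R) f" if "y \<in> G" for y
  proof (rule bounded_derivative_imp_lipschitz)
    fix z assume "z \<in> cball y R"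
    then have z: "z \<in> K" using K that by blast
    show "(f has_derivative ?f' z) (at z within cball y R)"
      using der z K has_derivative_at_withinI by blast
    show "onorm (?f' z) \<le> L"
    proof (rule onorm_le)
      fix v
      have "linear (?f' z)" using z K der has_derivative_linear by blast
      then have "norm (?f' z v) \<le> (\<Sum>b\<in>Basis. norm (?f' z b)) * norm v"
        by (rule norm_linear_le_sum_Basis)
      also have "\<dots> \<le> L * norm v" using L z by (intro mult_right_mono) auto
      finally show "norm (?f' z v) \<le> L * norm v" .
    qed
  qed (use L in auto)
  then have "\<forall>\<^sub>F r in at_right 0. \<forall>y\<in>G. cball y r \<subseteq> U \<and> L-lipschitz_on (cball y r) f"
    using K
    by (intro eventually_at_right_downward[of R]) (force intro: lipschitz_on_subset)+
  with L that show ?thesis by blast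
qed

lemma gradient_works:
  fixes f :: "'a::euclidean_space \<Rightarrow> real"
  assumes "f differentiable (at x)"
  shows "GDERIV f x :> gradient f x"
    and "gradient f x = (\<Sum>b\<in>Basis. frechet_derivative f (at x) b *\<^sub>R b)"
    and "frechet_derivative f (at x) v = gradient f x \<bullet> v"
proof -
  let ?f' = "frechet_derivative f (at x)"
  define g where "g = (\<Sum>b\<in>Basis. ?f' b *\<^sub>R b)"
  have der: "(f has_derivative ?f') (at x)" using assms frechet_derivative_works by blast
  then have l: "linear ?f'" by (rule has_derivative_linear)
  have f': "?f' v = v \<bullet> g" for v
  proof -
    have "?f' v = ?f' (\<Sum>b\<in>Basis. (v \<bullet> b) *\<^sub>R b)" by (simp add: euclidean_representation)
    also have "\<dots> = (\<Sum>b\<in>Basis. (v \<bullet> b) * ?f' b)"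
      by (simp add: linear_sum[OF l] linear_scale[OF l])
    finally show ?thesis by (simp add: g_def inner_sum_right mult.commute)
  qed
  then have "?f' = (\<lambda>v. v \<bullet> g)" by (rule ext)
  then have g: "GDERIV f x :> g" using der by (simp add: gderiv_def)
  have eq: "gradient f x = g" unfolding gradient_def
  proof (rule the_equality)
    fix g' assume "GDERIV f x :> g'"
    then have "(\<lambda>v. v \<bullet> g') = (\<lambda>v. v \<bullet> g)"
      using g unfolding gderiv_def by (rule has_derivative_unique)
    then show "g' = g" by (metis vector_eq_rdot inner_commute)
  qed (fact g)
  show "GDERIV f x :> gradient f x" "gradient f x = (\<Sum>b\<in>Basis. ?f' b *\<^sub>R b)"
    "?f' v = gradient f x \<bullet> v"
    using eq g f'[of v] by (simp_all only: g_def inner_commute)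
qed

lemma continuous_on_gradient:
  fixes f :: "'a::euclidean_space \<Rightarrow> real"
  assumes "Ck_on (Suc 0) f U"
  shows "continuous_on U (gradient f)"
proof -
  have "continuous_on U (\<lambda>x. \<Sum>b\<in>Basis. frechet_derivative f (at x) b *\<^sub>R b)"
    using assms by (intro continuous_intros) auto
  then show ?thesis using assms by (simp add: gradient_works(2) cong: continuous_on_cong)
qed

section \<open>Growth of solutions of linear differential inequalities\<close>

text \<open>Gronwall's inequality in differential form: \<open>\<parallel>z\<parallel>\<^sup>2 exp (- 2 G)\<close> does not increase. Working with \<open>z \<bullet> z\<close>
avoids the points where the norm is not differentiable.\<close>

lemma linear_growth_upper:
  fixes z f :: "real \<Rightarrow> 'a::real_inner"
  assumes "a \<le> b"
    and z: "\<And>t. t \<in> {a..b} \<Longrightarrow> (z has_vector_derivative f t) (at t within {a..b})"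
    and G: "\<And>t. t \<in> {a..b} \<Longrightarrow> (G has_real_derivative w t) (at t within {a..b})"
    and le: "\<And>t. t \<in> {a..b} \<Longrightarrow> f t \<bullet> z t \<le> w t * (norm (z t))\<^sup>2"
  shows "norm (z b) \<le> norm (z a) * exp (G b - G a)"
proof -
  define \<psi> where "\<psi> t = (z t \<bullet> z t) * exp (- 2 * (G t - G a))" for t
  have der: "(\<psi> has_real_derivative
      2 * (f t \<bullet> z t - w t * (norm (z t))\<^sup>2) * exp (- 2 * (G t - G a))) (at t within {a..b})"
    if "t \<in> {a..b}" for t
  proof -
    have "((\<lambda>t. z t \<bullet> z t) has_real_derivative 2 * (f t \<bullet> z t)) (at t within {a..b})"
      using bounded_bilinear.has_vector_derivative[OF bounded_bilinear_inner z[OF that] z[OF that]]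
      by (simp add: has_real_derivative_iff_has_vector_derivative inner_commute)
    then show ?thesis unfolding \<psi>_def
      by (auto intro!: derivative_eq_intros G that simp: power2_norm_eq_inner algebra_simps)
  qed
  have "\<psi> a \<ge> \<psi> b"
  proof (rule DERIV_nonpos_imp_decreasing_open[OF \<open>a \<le> b\<close>])
    fix t assume t: "a < t" "t < b"
    show "\<exists>y. (\<psi> has_real_derivative y) (at t) \<and> y \<le> 0"
      using der[of t] le[of t] t at_within_Icc_at[of a t b]
      by (intro exI[of _ "2 * (f t \<bullet> z t - w t * (norm (z t))\<^sup>2) * exp (- 2 * (G t - G a))"])
         (auto simp: mult_le_0_iff)
  next
    show "continuous_on {a..b} \<psi>"
      by (rule DERIV_continuous_on[OF der])
  qed
  then have "(norm (z b))\<^sup>2 * exp (- 2 * (G b - G a)) \<le> (norm (z a))\<^sup>2"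
    by (simp add: \<psi>_def power2_norm_eq_inner)
  then have "(norm (z b))\<^sup>2 * exp (- 2 * (G b - G a)) * exp (2 * (G b - G a)) \<le> (norm (z a))\<^sup>2 * exp (2 * (G b - G a))"
    by (rule mult_right_mono) simp
  then have "(norm (z b))\<^sup>2 \<le> (norm (z a) * exp (G b - G a))\<^sup>2"
    by (simp add: power_mult_distrib mult.assoc flip: exp_add exp_of_nat_mult)
  then show ?thesis by (rule power2_le_imp_le) simp
qed

text \<open>The preceding estimate for the time-reversed curve \<open>t \<mapsto> z (- t)\<close>.\<close>

lemma linear_growth_lower:
  fixes z f :: "real \<Rightarrow> 'a::real_inner"
  assumes "a \<le> b"
    and z: "\<And>t. t \<in> {a..b} \<Longrightarrow> (z has_vector_derivative f t) (at t within {a..b})"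
    and G: "\<And>t. t \<in> {a..b} \<Longrightarrow> (G has_real_derivative w t) (at t within {a..b})"
    and ge: "\<And>t. t \<in> {a..b} \<Longrightarrow> w t * (norm (z t))\<^sup>2 \<le> f t \<bullet> z t"
  shows "norm (z a) * exp (G b - G a) \<le> norm (z b)"
proof -
  have im: "uminus ` {-b..-a} = {a..b}" by force
  have "norm (z (- (- a))) \<le> norm (z (- (- b))) * exp (G (- (- a)) - G (- (- b)))"
  proof (rule linear_growth_upper[where z = "\<lambda>t. z (- t)" and G = "\<lambda>t. G (- t)"])
    fix t assume t: "t \<in> {-b..-a}"
    then have t': "- t \<in> {a..b}" by auto
    have m: "(uminus has_real_derivative -1) (at t within {-b..-a})"
      by (auto intro!: derivative_eq_intros)
    show "((\<lambda>t. z (- t)) has_vector_derivative - f (- t)) (at t within {-b..-a})"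
      using vector_diff_chain_within[OF m[unfolded has_real_derivative_iff_has_vector_derivative], of z "f (- t)"] z[OF t'] im
      by (simp add: o_def)
    show "((\<lambda>t. G (- t)) has_real_derivative - w (- t)) (at t within {-b..-a})"
      using DERIV_image_chain[of G "w (-t)" uminus t "{-b..-a}" "-1"] G[OF t'] im m by (simp add: o_def)
    show "(- f (- t)) \<bullet> z (- t) \<le> (- w (- t)) * (norm (z (- t)))\<^sup>2"
      using ge[OF t'] by simp
  qed (use assms in simp)
  then have "norm (z a) * exp (G b - G a) \<le> norm (z b) * exp (G a - G b) * exp (G b - G a)"
    by (intro mult_right_mono) auto
  then show ?thesis by (simp add: mult.assoc flip: exp_add)
qed

section \<open>Global solutions of Lipschitz equations\<close>

lemma integral_has_vector_derivative_halfline: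
  fixes g :: "real \<Rightarrow> 'a::banach"
  assumes "continuous_on {0..} g" "t \<ge> 0"
  shows "((\<lambda>s. integral {0..s} g) has_vector_derivative g t) (at t within {0..})"
proof -
  have "((\<lambda>s. integral {0..s} g) has_vector_derivative g t) (at t within {0..t+1})"
    using assms by (intro integral_has_vector_derivative) (auto intro: continuous_on_subset)
  moreover have "at t within {0..t+1} = at t within {0..}"
    by (rule at_within_nhd[of t "{..<t+1}"]) auto
  ultimately show ?thesis by simp
qed

text \<open>The source of the contraction constant \<open>1/2\<close> in the fixed point argument below: the weight
\<open>exp (- 2 L s)\<close> decays twice as fast as a Lipschitz constant \<open>L\<close> can make differences grow.\<close>

lemma norm_weighted_integral_le:
  fixes g :: "real \<Rightarrow> 'a::banach"
  assumes "continuous_on {0..} g" "L > 0" "C \<ge> 0" "s \<ge> 0"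
    and le: "\<And>u. u \<ge> 0 \<Longrightarrow> norm (g u) \<le> L * (exp (2 * L * u) * C)"
  shows "norm (exp (- 2 * L * s) *\<^sub>R integral {0..s} g) \<le> C / 2"
proof -
  have "((\<lambda>u. L * (exp (2 * L * u) * C)) has_integral exp (2 * L * s) * C / 2 - exp (2 * L * 0) * C / 2) {0..s}"
    using \<open>s \<ge> 0\<close>
    by (intro fundamental_theorem_of_calculus)
       (auto intro!: derivative_eq_intros simp: has_real_derivative_iff_has_vector_derivative[symmetric])
  moreover have "g integrable_on {0..s}"
    using assms(1) by (intro integrable_continuous_real) (auto intro: continuous_on_subset)
  ultimately have "norm (integral {0..s} g) \<le> exp (2 * L * s) * C / 2 - C / 2"
    using integral_norm_bound_integral[of g "{0..s}" "\<lambda>u. L * (exp (2 * L * u) * C)"] le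
    by (auto simp: has_integral_iff)
  then have "norm (integral {0..s} g) \<le> exp (2 * L * s) * C / 2" using \<open>C \<ge> 0\<close> by simp
  then have "exp (- 2 * L * s) * norm (integral {0..s} g) \<le> exp (- 2 * L * s) * (exp (2 * L * s) * C / 2)"
    by (rule mult_left_mono) simp
  also have "\<dots> = C / 2" by (simp flip: exp_add mult.assoc)
  finally show ?thesis by simp
qed

text \<open>Picard's theorem on the whole half line by a single application of Banach's fixed point theorem. The
unknown is \<open>w t = exp (- 2 L t) z t\<close> in the space of bounded continuous functions; in this weighted
norm the integral operator is a contraction on all of \<open>[0, \<infinity>)\<close>. The condition \<open>F t 0 = 0\<close>
guarantees that the operator maps bounded functions to bounded functions.\<close>

lemma global_solution_of_lipschitz_ode:
  fixes F :: "real \<Rightarrow> 'a::banach \<Rightarrow> 'a"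
  assumes cont: "continuous_on UNIV (\<lambda>(t, x). F t x)"
    and lip: "\<And>t. L-lipschitz_on UNIV (F t)" and "L > 0"
    and zero: "\<And>t. F t 0 = 0"
  obtains z where "z 0 = z0"
    "\<And>t. t \<ge> 0 \<Longrightarrow> (z has_vector_derivative F t (z t)) (at t within {0..})"
proof -
  define N where "N w u = F u (exp (2 * L * u) *\<^sub>R w u)" for w u
  define J where "J w s = exp (- 2 * L * s) *\<^sub>R (z0 + integral {0..s} (N w))" for w s
  have N_cont: "continuous_on {0..} (N w)" if "continuous_on UNIV w" for w
  proof -
    have "continuous_on UNIV (\<lambda>u. (u, exp (2 * L * u) *\<^sub>R w u))"
      using that by (intro continuous_intros)
    from continuous_on_compose2[OF cont this] have "continuous_on UNIV (N w)"
      by (simp add: N_def)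
    then show ?thesis by (rule continuous_on_subset) simp
  qed
  have N_diff: "norm (N w u - N v u) \<le> L * (exp (2 * L * u) * norm (w u - v u))" for w v u
    using lipschitz_onD[OF lip[of u], of "exp (2 * L * u) *\<^sub>R w u" "exp (2 * L * u) *\<^sub>R v u"]
    by (simp add: N_def dist_norm flip: scaleR_diff_right)
  have N_0: "N (\<lambda>_. 0) = (\<lambda>_. 0)" by (rule ext) (simp add: N_def zero)
  have N_int: "N w integrable_on {0..s}" if "continuous_on UNIV w" for w s
    using N_cont[OF that] by (intro integrable_continuous_real) (auto intro: continuous_on_subset)
  have J_diff: "norm (J w s - J v s) \<le> C / 2"
    if "s \<ge> 0" "C \<ge> 0" "continuous_on UNIV w" "continuous_on UNIV v" "\<And>u. norm (w u - v u) \<le> C" for w v s C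
  proof -
    have "J w s - J v s = exp (- 2 * L * s) *\<^sub>R integral {0..s} (\<lambda>u. N w u - N v u)"
      using N_int that by (simp add: J_def integral_diff flip: scaleR_diff_right)
    also have "norm \<dots> \<le> C / 2"
    proof (rule norm_weighted_integral_le)
      fix u :: real
      have "L * (exp (2 * L * u) * norm (w u - v u)) \<le> L * (exp (2 * L * u) * C)"
        using that(5) \<open>L > 0\<close> by (intro mult_left_mono) auto
      then show "norm (N w u - N v u) \<le> L * (exp (2 * L * u) * C)"
        using N_diff order_trans by blast
    qed (use that N_cont \<open>L > 0\<close> in \<open>auto intro: continuous_on_diff\<close>)
    finally show ?thesis .
  qed
  \<comment> \<open>Bounded continuous functions live on all of \<open>\<real>\<close>; negative times are clamped to \<open>0\<close>.\<close>
  have J_bcont: "(\<lambda>t. J w (max 0 t)) \<in> bcontfun" if wb: "w \<in> bcontfun" for w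
  proof -
    have w: "continuous_on UNIV w" using wb by (simp add: bcontfun_def)
    obtain C where C: "\<And>u. norm (w u) \<le> C" 
      using wb unfolding bcontfun_def bounded_iff by blast
    have C0: "C \<ge> 0" using C[of 0] norm_ge_zero order_trans by blast
    have "continuous_on {0..} (\<lambda>s. integral {0..s} (N w))"
      by (intro continuous_on_vector_derivative[where f' = "N w"]
          integral_has_vector_derivative_halfline N_cont w) auto
    then have "continuous_on {0..} (J w)"
      unfolding J_def by (intro continuous_intros)
    then have c: "continuous_on UNIV (\<lambda>t. J w (max 0 t))"
      by (rule continuous_on_compose2) (auto intro!: continuous_intros)
    have "norm (J w (max 0 t)) \<le> norm z0 + C / 2" for t
    proof -
      have "norm (J w (max 0 t) - J (\<lambda>_. 0) (max 0 t)) \<le> C / 2"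
        by (rule J_diff) (use w C C0 in auto)
      moreover have "norm (J (\<lambda>_. 0) (max 0 t)) \<le> norm z0"
      proof -
        have "exp (- 2 * L * max 0 t) * norm z0 \<le> 1 * norm z0"
          using \<open>L > 0\<close> by (intro mult_right_mono) auto
        then show ?thesis by (simp add: J_def N_0)
      qed
      ultimately show ?thesis
        using norm_triangle_sub[of "J w (max 0 t)" "J (\<lambda>_. 0) (max 0 t)"] by linarith
    qed
    with c show ?thesis by (rule bcontfun_normI)
  qed
  define \<Phi> where "\<Phi> w = Bcontfun (\<lambda>t. J (apply_bcontfun w) (max 0 t))" for w
  have \<Phi>: "apply_bcontfun (\<Phi> w) t = J (apply_bcontfun w) (max 0 t)" for w t
    unfolding \<Phi>_def by (simp add: J_bcont apply_bcontfun Bcontfun_inverse)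
  have "dist (\<Phi> w) (\<Phi> v) \<le> 1/2 * dist w v" for w v
  proof (rule dist_bound)
    fix t
    have "norm (J (apply_bcontfun w) (max 0 t) - J (apply_bcontfun v) (max 0 t)) \<le> dist w v / 2"
      by (rule J_diff) (use dist_bounded[of w _ v] in \<open>auto simp: dist_norm\<close>)
    then show "dist (apply_bcontfun (\<Phi> w) t) (apply_bcontfun (\<Phi> v) t) \<le> 1/2 * dist w v"
      by (simp add: \<Phi> dist_norm)
  qed
  then obtain w where w: "\<Phi> w = w"
    using banach_fix_type[of "1/2" \<Phi>] by auto
  define z where "z t = exp (2 * L * t) *\<^sub>R apply_bcontfun w t" for t
  have N: "N (apply_bcontfun w) u = F u (z u)" for u by (simp add: N_def z_def)
  have z: "z t = z0 + integral {0..t} (N (apply_bcontfun w))" if "t \<ge> 0" for t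
  proof -
    have "apply_bcontfun w t = J (apply_bcontfun w) t" using \<Phi>[of w t] w that by simp
    then show ?thesis by (simp add: z_def J_def flip: exp_add)
  qed
  show ?thesis
  proof
    show "z 0 = z0" using z[of 0] by simp
    fix t :: real assume t: "t \<ge> 0"
    have "((\<lambda>s. z0 + integral {0..s} (N (apply_bcontfun w))) has_vector_derivative 0 + N (apply_bcontfun w) t) (at t within {0..})"
      using t N_cont by (intro has_vector_derivative_add has_vector_derivative_const
          integral_has_vector_derivative_halfline) auto
    then show "(z has_vector_derivative F t (z t)) (at t within {0..})"
      using t z by (intro has_vector_derivative_transform[of t "{0..}" z]) (auto simp: N)
  qed
qed

text \<open>A bootstrap: the differential inequality is known only while \<open>\<parallel>z\<parallel> \<le> r\<close>, but the bound it implies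
is smaller than \<open>r\<close>, so a first time with \<open>\<parallel>z\<parallel> = r\<close> cannot exist.\<close>

lemma growth_below_threshold:
  fixes z f :: "real \<Rightarrow> 'a::real_inner"
  assumes z: "\<And>t. t \<in> {a..b} \<Longrightarrow> (z has_vector_derivative f t) (at t within {a..b})"
    and f: "\<And>t. t \<in> {a..b} \<Longrightarrow> norm (z t) \<le> r \<Longrightarrow> norm (f t) \<le> L * norm (z t)"
    and small: "norm (z a) * exp (L * (b - a)) < r" and "L \<ge> 0"
    and t: "t \<in> {a..b}"
  shows "norm (z t) \<le> norm (z a) * exp (L * (t - a))"
proof -
  have cont: "continuous_on {a..b} (\<lambda>t. norm (z t))"
    by (intro continuous_on_norm continuous_on_vector_derivative[OF z])
  have growth: "norm (z s) \<le> norm (z a) * exp (L * (s - a))"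
    if "s \<in> {a..b}" "\<And>u. u \<in> {a..s} \<Longrightarrow> norm (z u) \<le> r" for s
  proof -
    have "norm (z s) \<le> norm (z a) * exp (L * s - L * a)"
    proof (rule linear_growth_upper)
      fix u assume u: "u \<in> {a..s}"
      then have u': "u \<in> {a..b}" using that by auto
      show "(z has_vector_derivative f u) (at u within {a..s})"
        using z[OF u'] by (rule has_vector_derivative_within_subset) (use that in auto)
      show "((\<lambda>u. L * u) has_real_derivative L) (at u within {a..s})"
        by (auto intro!: derivative_eq_intros)
      have "f u \<bullet> z u \<le> norm (f u) * norm (z u)" by (rule norm_cauchy_schwarz)
      also have "\<dots> \<le> L * norm (z u) * norm (z u)"
        using f[OF u'] that u by (intro mult_right_mono) auto
      finally show "f u \<bullet> z u \<le> L * (norm (z u))\<^sup>2" by (simp add: power2_eq_square)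
    qed (use that in auto)
    then show ?thesis by (simp add: right_diff_distrib)
  qed
  have exp_le: "norm (z a) * exp (L * (s - a)) < r" if "s \<in> {a..b}" for s
  proof -
    have "norm (z a) * exp (L * (s - a)) \<le> norm (z a) * exp (L * (b - a))"
      using that \<open>L \<ge> 0\<close> by (intro mult_left_mono) (auto intro!: mult_left_mono)
    then show ?thesis using small by simp
  qed
  have za: "norm (z a) < r" using exp_le[of a] t by simp
  have hit: "\<exists>v. v \<in> {a..u} \<and> norm (z v) = r" if "u \<in> {a..b}" "\<not> norm (z u) \<le> r" for u
    using IVT'[of "\<lambda>t. norm (z t)" a r u] that za continuous_on_subset[OF cont, of "{a..u}"] by force
  have "norm (z s) \<le> r" if sab: "s \<in> {a..b}" for s
  proof (rule ccontr)
    assume "\<not> norm (z s) \<le> r"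
    define S where "S = {v \<in> {a..b}. norm (z v) \<in> {r}}"
    \<comment> \<open>The set of hitting times of the threshold is compact and nonempty, hence has a least element.\<close>
    obtain v where "v \<in> {a..s}" "norm (z v) = r" using hit[OF sab \<open>\<not> norm (z s) \<le> r\<close>] by blast
    then have "v \<in> S" using sab by (auto simp: S_def)
    then have "S \<noteq> {}" by blast
    moreover have "compact S"
    proof -
      have "S = {a..b} \<inter> (\<lambda>t. norm (z t)) -` {r}" by (auto simp: S_def)
      then have "closed S" using continuous_closed_preimage[OF cont, of "{r}"] by simp
      moreover have "bounded S"
        by (rule bounded_subset[OF bounded_closed_interval[of a b]]) (auto simp: S_def)
      ultimately show ?thesis by (simp add: compact_eq_bounded_closed)
    qed
    ultimately obtain m where m: "m \<in> S" "\<And>v. v \<in> S \<Longrightarrow> m \<le> v"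
      using compact_attains_inf[of S] by blast
    have "norm (z u) \<le> r" if um: "u \<in> {a..m}" for u
    proof (rule ccontr)
      assume "\<not> norm (z u) \<le> r"
      then obtain v where v: "v \<in> {a..u}" "norm (z v) = r" using hit[of u] um m by (auto simp: S_def)
      then have "m \<le> v" using m um by (auto simp: S_def)
      then have "v = u" using v um by auto
      then show False using v \<open>\<not> norm (z u) \<le> r\<close> by simp
    qed
    then have "norm (z m) < r" using growth[of m] exp_le[of m] m by (auto simp: S_def)
    then show False using m by (simp add: S_def)
  qed
  then show ?thesis using growth t by auto
qed

section \<open>A Lipschitz tube around a periodic orbit\<close>

lemma periodic_orbit_period_nat:
  assumes "T_periodic_solution U X T \<gamma>"
  shows "\<gamma> (t + real n * T) = \<gamma> t"
proof (induction n)
  case (Suc n)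
  have "\<gamma> (t + real n * T + T) = \<gamma> (t + real n * T)"
    using assms by (simp add: T_periodic_solution_def)
  then show ?case using Suc by (simp add: algebra_simps)
qed simp

lemma periodic_orbit_mem:
  assumes "T_periodic_solution U X T \<gamma>"
  shows "\<gamma> t \<in> \<gamma> ` {0..T}"
proof -
  have T: "T > 0" using assms by (simp add: T_periodic_solution_def)
  obtain n :: nat where n: "- t / T \<le> real n" using real_arch_simple by blast
  define s where "s = t + real n * T"
  have "s \<ge> 0" using n T by (simp add: s_def field_simps)
  define m where "m = nat \<lfloor>s / T\<rfloor>"
  have m: "real m \<le> s / T" "s / T < real m + 1"
    using \<open>s \<ge> 0\<close> T unfolding m_def by (auto simp: of_nat_nat)
  then have "s - real m * T \<in> {0..T}" using T by (auto simp: field_simps)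
  moreover have "\<gamma> (s - real m * T) = \<gamma> t"
    using periodic_orbit_period_nat[OF assms, of "s - real m * T" m] periodic_orbit_period_nat[OF assms, of t n] by (simp add: s_def)
  ultimately show ?thesis by (metis imageI)
qed

text \<open>The radius \<open>r\<close> is common to all points of the orbit. By compactness such a tube exists around every
periodic orbit of a vector field of class \<open>C\<^sup>1\<close>, with arbitrarily small \<open>r\<close> and the same \<open>L\<close>.\<close>

locale orbit_tube =
  fixes U :: "'a::euclidean_space set" and X :: "'a \<Rightarrow> 'a" and T :: real and \<gamma> :: "real \<Rightarrow> 'a"
    and r L :: real
  assumes periodic: "T_periodic_solution U X T \<gamma>"
    and X_cont: "continuous_on U X"
    and r_pos: "r > 0" and L_pos: "L > 0"
    and tube: "cball (\<gamma> t) r \<subseteq> U"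
    and lipschitz: "L-lipschitz_on (cball (\<gamma> t) r) X"
begin

lemma T_pos: "T > 0" using periodic by (simp add: T_periodic_solution_def)

lemma orbit_period: "\<gamma> (t + T) = \<gamma> t" using periodic by (simp add: T_periodic_solution_def)

lemma orbit_derivative: "(\<gamma> has_vector_derivative X (\<gamma> t)) (at t within S)"
  using periodic has_vector_derivative_within_subset[of \<gamma> _ t UNIV S]
  by (simp add: T_periodic_solution_def solution_on_def)

lemma orbit_derivative_shift:
  "((\<lambda>t. \<gamma> (\<theta> + t - a)) has_vector_derivative X (\<gamma> (\<theta> + t - a))) (at t within S)"
proof -
  have "((\<lambda>t. \<theta> + t - a) has_vector_derivative 1) (at t within S)"
    by (auto intro!: derivative_eq_intros)
  from vector_diff_chain_within[OF this orbit_derivative] show ?thesis by (simp add: o_def)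
qed

lemma orbit_period_nat: "\<gamma> (t + real n * T) = \<gamma> t"
  by (rule periodic_orbit_period_nat[OF periodic])

lemma orbit_mem: "\<gamma> t \<in> \<gamma> ` {0..T}"
  by (rule periodic_orbit_mem[OF periodic])

text \<open>The curve \<open>x\<close> is only required to follow the vector field while it is in the tube, so that the lemma
applies to the cut-off solutions below as well as to genuine solutions.\<close>

lemma shadowing:
  assumes x: "\<And>t. t \<in> {a..b} \<Longrightarrow> (x has_vector_derivative f t) (at t within {a..b})"
    and f: "\<And>t. t \<in> {a..b} \<Longrightarrow> dist (x t) (\<gamma> (\<theta> + t - a)) \<le> r \<Longrightarrow> f t = X (x t)"
    and small: "dist (x a) (\<gamma> \<theta>) * exp (L * (b - a)) < r"
    and t: "t \<in> {a..b}"
  shows "dist (x t) (\<gamma> (\<theta> + t - a)) \<le> dist (x a) (\<gamma> \<theta>) * exp (L * (t - a))"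
proof -
  let ?y = "\<lambda>t. \<gamma> (\<theta> + t - a)"
  have "norm (x t - ?y t) \<le> norm (x a - ?y a) * exp (L * (t - a))"
  proof (rule growth_below_threshold)
    fix s assume s: "s \<in> {a..b}"
    show "((\<lambda>t. x t - ?y t) has_vector_derivative f s - X (?y s)) (at s within {a..b})"
      using x[OF s] orbit_derivative_shift by (rule has_vector_derivative_diff)
    assume le: "norm (x s - ?y s) \<le> r"
    then have "f s = X (x s)" using f[OF s] by (simp add: dist_norm)
    moreover have "dist (X (x s)) (X (?y s)) \<le> L * dist (x s) (?y s)"
      using le r_pos by (intro lipschitz_onD[OF lipschitz[of "\<theta> + s - a"]])
        (auto simp: dist_norm norm_minus_commute)
    ultimately show "norm (f s - X (?y s)) \<le> L * norm (x s - ?y s)" by (simp add: dist_norm)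
  qed (use small L_pos t in \<open>auto simp: dist_norm\<close>)
  then show ?thesis by (simp add: dist_norm)
qed

text \<open>Replacing the difference \<open>z\<close> of \<open>x\<close> and \<open>\<gamma> (\<theta> + \<cdot>)\<close> by its metric projection \<open>P z\<close> onto the ball of
radius \<open>r\<close>, which is nonexpansive, turns the equation for \<open>z\<close> into a globally Lipschitz one with the
solution \<open>0\<close>. Nothing changes as long as the curve is in the tube.\<close>

lemma cutoff_solution:
  obtains x f where "x 0 = x0"
    "\<And>t. t \<ge> 0 \<Longrightarrow> (x has_vector_derivative f t) (at t within {0..})"
    "\<And>t. t \<ge> 0 \<Longrightarrow> dist (x t) (\<gamma> (\<theta> + t)) \<le> r \<Longrightarrow> f t = X (x t)"
proof -
  define P where "P = closest_point (cball (0::'a) r)"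
  define F where "F t z = X (\<gamma> (\<theta> + t) + P z) - X (\<gamma> (\<theta> + t))" for t z
  have ne: "cball (0::'a) r \<noteq> {}" using r_pos by auto
  have P_in: "norm (P z) \<le> r" for z
    using closest_point_in_set[OF closed_cball ne, of z] by (simp add: P_def)
  have P_id: "P z = z" if "norm z \<le> r" for z
    using that by (simp add: P_def closest_point_self)
  have P_lip: "dist (P z) (P z') \<le> dist z z'" for z z'
    unfolding P_def by (rule closest_point_lipschitz[OF convex_cball closed_cball ne])
  have in_tube: "\<gamma> s + P z \<in> cball (\<gamma> s) r" for s z
    using P_in by (simp add: dist_norm)
  have P_cont: "continuous_on UNIV P"
    unfolding P_def by (rule continuous_on_closest_point[OF convex_cball closed_cball ne])
  have \<gamma>_cont: "continuous_on UNIV \<gamma>"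
    using orbit_derivative by (intro continuous_on_vector_derivative)
  have cont: "continuous_on UNIV (\<lambda>(t, z). F t z)"
  proof -
    have 1: "continuous_on UNIV (\<lambda>q. \<gamma> (\<theta> + fst q))"
      by (rule continuous_on_compose2[OF \<gamma>_cont]) (auto intro!: continuous_intros)
    have 2: "continuous_on UNIV (\<lambda>q. P (snd q))"
      by (rule continuous_on_compose2[OF P_cont]) (auto intro!: continuous_intros)
    have 3: "\<gamma> s \<in> U" for s using tube[of s] r_pos by auto
    have 4: "\<gamma> s + P z \<in> U" for s z using tube in_tube by blast
    have "continuous_on UNIV (\<lambda>q. X (\<gamma> (\<theta> + fst q) + P (snd q)) - X (\<gamma> (\<theta> + fst q)))"
      using 3 4 by (intro continuous_on_diff continuous_on_compose2[OF X_cont] continuous_on_add 1 2) auto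
    then show ?thesis by (simp add: F_def case_prod_unfold)
  qed
  have lip: "L-lipschitz_on UNIV (F t)" for t
  proof (rule lipschitz_onI)
    fix z z'
    have "dist (F t z) (F t z') = dist (X (\<gamma> (\<theta> + t) + P z)) (X (\<gamma> (\<theta> + t) + P z'))"
      by (simp add: F_def dist_norm)
    also have "\<dots> \<le> L * dist (\<gamma> (\<theta> + t) + P z) (\<gamma> (\<theta> + t) + P z')"
      by (rule lipschitz_onD[OF lipschitz in_tube in_tube])
    also have "\<dots> \<le> L * dist z z'" using P_lip L_pos by simp
    finally show "dist (F t z) (F t z') \<le> L * dist z z'" .
  qed (use L_pos in simp)
  have zero: "F t 0 = 0" for t using P_id r_pos by (simp add: F_def)
  obtain z where z: "z 0 = x0 - \<gamma> \<theta>"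
    "\<And>t. t \<ge> 0 \<Longrightarrow> (z has_vector_derivative F t (z t)) (at t within {0..})"
    using global_solution_of_lipschitz_ode[OF cont lip L_pos zero] by blast
  show ?thesis
  proof
    show "z 0 + \<gamma> (\<theta> + 0) = x0" using z by simp
    fix t :: real assume t: "t \<ge> 0"
    show "((\<lambda>t. z t + \<gamma> (\<theta> + t)) has_vector_derivative F t (z t) + X (\<gamma> (\<theta> + t))) (at t within {0..})"
      using has_vector_derivative_add[OF z(2)[OF t] orbit_derivative_shift[of \<theta> 0]] by simp
    show "dist (z t + \<gamma> (\<theta> + t)) (\<gamma> (\<theta> + t)) \<le> r \<Longrightarrow> F t (z t) + X (\<gamma> (\<theta> + t)) = X (z t + \<gamma> (\<theta> + t))"
      using P_id by (simp add: F_def dist_norm add.commute)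
  qed
qed

end

section \<open>First integrals and multipliers\<close>

lemma C1_uniformly_close:
  fixes f :: "'a::euclidean_space \<Rightarrow> real"
  assumes "open U" "compact G" "G \<noteq> {}" "G \<subseteq> U" "Ck_on (Suc 0) f U" "\<eta> > 0"
  shows "\<forall>\<^sub>F r in at_right 0. \<forall>y\<in>G. \<forall>x\<in>cball y r. \<bar>f x - f y\<bar> \<le> \<eta>"
proof -
  obtain L where L: "L > 0"
    "\<forall>\<^sub>F r in at_right 0. \<forall>y\<in>G. cball y r \<subseteq> U \<and> L-lipschitz_on (cball y r) f"
    by (rule C1_lipschitz_tube[OF assms(1-5)])
  have "\<forall>\<^sub>F r in at_right 0. r \<le> \<eta> / L"
    using L \<open>\<eta> > 0\<close> by (intro eventually_at_right_downward[of "\<eta> / L"]) auto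
  then show ?thesis using L(2) eventually_at_right_less[of 0]
  proof eventually_elim
    case (elim r)
    show ?case
    proof (intro ballI)
      fix y x assume yx: "y \<in> G" "x \<in> cball y r"
      have "dist (f x) (f y) \<le> L * dist x y"
        using elim yx by (intro lipschitz_onD[of L "cball y r" f]) auto
      also have "\<dots> \<le> L * (\<eta> / L)"
        using yx elim L by (intro mult_left_mono) (auto simp: dist_commute)
      finally show "\<bar>f x - f y\<bar> \<le> \<eta>" using L by (simp add: dist_real_def)
    qed
  qed
qed

lemma lie_derivative_along_solution:
  fixes F :: "'a::euclidean_space \<Rightarrow> real"
  assumes "F differentiable (at (x t))" "(x has_vector_derivative X (x t)) (at t within S)"
  shows "((\<lambda>t. F (x t)) has_real_derivative lie_derivative X F (x t)) (at t within S)"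
proof -
  have "(F has_derivative (\<lambda>v. v \<bullet> gradient F (x t))) (at (x t) within x ` S)"
    using gradient_works(1)[OF assms(1)] by (simp add: gderiv_def has_derivative_at_withinI)
  from vector_derivative_diff_chain_within[OF assms(2) this] show ?thesis
    by (simp add: o_def lie_derivative_def has_real_derivative_iff_has_vector_derivative)
qed

lemma first_integral_zero:
  fixes F :: "'a::euclidean_space \<Rightarrow> real"
  assumes sol: "solution_on U X {a..b} x" and "a \<le> b"
    and F: "\<And>y. y \<in> U \<Longrightarrow> F differentiable (at y)" "\<And>y. y \<in> U \<Longrightarrow> lie_derivative X F y = 0"
    and "F (x a) = 0"
  shows "F (x b) = 0"
proof -
  have "norm (F (x b)) \<le> norm (F (x a)) * exp (0 - 0)"
  proof (rule linear_growth_upper[where z = "\<lambda>t. F (x t)" and f = "\<lambda>_. 0" and G = "\<lambda>_. 0" and w = "\<lambda>_. 0"])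
    fix t assume "t \<in> {a..b}"
    then have "x t \<in> U" "(x has_vector_derivative X (x t)) (at t within {a..b})"
      using sol by (auto simp: solution_on_def)
    then show "((\<lambda>t. F (x t)) has_vector_derivative 0) (at t within {a..b})"
      using lie_derivative_along_solution[of F x t X "{a..b}"] F
      by (simp add: has_real_derivative_iff_has_vector_derivative)
  qed (use \<open>a \<le> b\<close> in auto)
  then show ?thesis using assms by simp
qed

text \<open>Over any interval of length \<open>T\<close> a \<open>T\<close>-periodic function has the same integral. Phases can be chosen in
\<open>[0, T]\<close>, so antiderivatives on \<open>[0, 2 T]\<close> suffice.\<close>

lemma periodic_antiderivative:
  fixes g :: "real \<Rightarrow> real"
  assumes cont: "continuous_on UNIV g" and per: "\<And>t. g (t + T) = g t" and \<theta>: "\<theta> \<in> {0..T}"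
  obtains H where
    "\<And>t. t \<in> {\<theta>..\<theta> + T} \<Longrightarrow> (H has_real_derivative g t) (at t within {\<theta>..\<theta> + T})"
    "H (\<theta> + T) - H \<theta> = integral {0..T} g"
proof -
  obtain H where H: "\<And>t. t \<in> {0..2*T} \<Longrightarrow> (H has_vector_derivative g t) (at t within {0..2*T})"
    using antiderivative_continuous[of 0 "2*T" g] continuous_on_subset[OF cont] by auto
  have Hs: "(H has_real_derivative g t) (at t within S)" if "t \<in> {0..2*T}" "S \<subseteq> {0..2*T}" for t S
    using has_vector_derivative_within_subset[OF H[OF that(1)] that(2)]
    by (simp add: has_real_derivative_iff_has_vector_derivative)
  have "((\<lambda>t. H (t + T) - H t) has_real_derivative 0) (at t within {0..T})" if t: "t \<in> {0..T}" for t
  proof -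
    have "((\<lambda>t. t + T) has_real_derivative 1) (at t within {0..T})"
      by (auto intro!: derivative_eq_intros)
    moreover have "(H has_real_derivative g (t + T)) (at (t + T) within (\<lambda>t. t + T) ` {0..T})"
      using t by (intro Hs) auto
    ultimately have "((\<lambda>t. H (t + T)) has_real_derivative g (t + T) * 1) (at t within {0..T})"
      using DERIV_image_chain[of H "g (t + T)" "\<lambda>t. t + T" t "{0..T}" 1] by (simp add: o_def)
    from DERIV_diff[OF this Hs[of t "{0..T}"]] t show ?thesis by (simp add: per)
  qed
  then obtain c where "\<And>t. t \<in> {0..T} \<Longrightarrow> H (t + T) - H t = c"
    using has_field_derivative_zero_constant[of "{0..T}" "\<lambda>t. H (t + T) - H t"] convex_real_interval by metis
  then have "H (\<theta> + T) - H \<theta> = H T - H 0" using \<theta> by force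
  also have "\<dots> = integral {0..T} g"
    using \<theta> Hs fundamental_theorem_of_calculus[of 0 T H g]
    by (simp add: has_real_derivative_iff_has_vector_derivative integral_unique)
  finally show ?thesis using that[of H] Hs \<theta> by auto
qed


section \<open>Distance from the common zero set in transversal directions\<close>

lemma eq_zero_of_orthogonal_independent_family:
  fixes v :: "'a::euclidean_space"
  assumes "independent_family vs" "length vs = DIM('a)" "\<And>u. u \<in> set vs \<Longrightarrow> u \<bullet> v = 0"
  shows "v = 0"
proof -
  have "card (set vs) = DIM('a)" "independent (set vs)"
    using assms by (auto simp: independent_family_def distinct_card)
  then have "UNIV \<subseteq> span (set vs)"
    by (intro card_ge_dim_independent) auto
  then have "v \<in> span (set vs)" by blast
  then have "orthogonal v v"
    using assms(3) by (intro orthogonal_to_span[of v "set vs"]) (auto simp: orthogonal_def inner_commute)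
  then show ?thesis by (simp add: orthogonal_self)
qed

text \<open>The quantity \<open>\<Sum>\<^sub>i \<bar>\<nabla>F\<^sub>i y \<bullet> v\<bar> + \<bar>X y \<bullet> v\<bar>\<close> is positive for unit vectors \<open>v\<close>, hence has a positive minimum
over \<open>y \<in> G\<close> by compactness. For \<open>v = x - y\<close> orthogonal to \<open>X y\<close> the second term drops out, and as
\<open>F\<^sub>i y = 0\<close>, the first one is \<open>\<Sum>\<^sub>i \<bar>F\<^sub>i x\<bar>\<close> up to the linearization error, which is made small enough to
cost only half of the minimum.\<close>

lemma transversal_distance_estimate:
  fixes F :: "nat \<Rightarrow> 'a::euclidean_space \<Rightarrow> real" and X :: "'a \<Rightarrow> 'a"
  assumes U: "open U" and G: "compact G" "G \<noteq> {}" "G \<subseteq> U"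
    and F: "\<And>i. i < m \<Longrightarrow> Ck_on (Suc 0) (F i) U" and X: "continuous_on U X"
    and zero: "\<And>i y. i < m \<Longrightarrow> y \<in> G \<Longrightarrow> F i y = 0"
    and indep: "\<And>y v. y \<in> G \<Longrightarrow> (\<And>i. i < m \<Longrightarrow> gradient (F i) y \<bullet> v = 0) \<Longrightarrow> X y \<bullet> v = 0 \<Longrightarrow> v = 0"
  obtains c where "c > 0"
    "\<forall>\<^sub>F r in at_right 0. \<forall>y\<in>G. \<forall>x\<in>cball y r. (x - y) \<bullet> X y = 0 \<longrightarrow> c * norm (x - y) \<le> (\<Sum>i<m. \<bar>F i x\<bar>)"
proof -
  define \<Phi> where "\<Phi> q = (\<Sum>i<m. \<bar>gradient (F i) (fst q) \<bullet> snd q\<bar>) + \<bar>X (fst q) \<bullet> snd q\<bar>" for q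
  let ?S = "G \<times> sphere (0::'a) 1"
  have "compact ?S" using G by (intro compact_Times) auto
  moreover have "?S \<noteq> {}" using G by (auto simp: sphere_eq_empty)
  moreover have "continuous_on ?S \<Phi>"
  proof -
    have fst: "continuous_on ?S (\<lambda>q. g (fst q))" if "continuous_on U g" for g :: "'a \<Rightarrow> 'a"
      using G by (intro continuous_on_compose2[OF that]) (auto intro!: continuous_intros)
    show ?thesis unfolding \<Phi>_def
      by (intro continuous_intros fst X continuous_on_gradient F) auto
  qed
  ultimately have "\<exists>q\<in>?S. \<forall>q'\<in>?S. \<Phi> q \<le> \<Phi> q'" by (rule continuous_attains_inf)
  then obtain q where q: "q \<in> ?S" "\<And>q'. q' \<in> ?S \<Longrightarrow> \<Phi> q \<le> \<Phi> q'" by blast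
  define c where "c = \<Phi> q"
  have "c > 0"
  proof (rule ccontr)
    assume "\<not> c > 0"
    then have "(\<Sum>i<m. \<bar>gradient (F i) (fst q) \<bullet> snd q\<bar>) + \<bar>X (fst q) \<bullet> snd q\<bar> \<le> 0"
      by (simp add: c_def \<Phi>_def)
    moreover have "0 \<le> (\<Sum>i<m. \<bar>gradient (F i) (fst q) \<bullet> snd q\<bar>)" by (intro sum_nonneg) simp
    ultimately have "(\<Sum>i<m. \<bar>gradient (F i) (fst q) \<bullet> snd q\<bar>) = 0" "X (fst q) \<bullet> snd q = 0" by linarith+
    then have "snd q = 0" using q by (intro indep[of "fst q"]) (auto simp: sum_nonneg_eq_0_iff)
    then show False using q by auto
  qed
  have bound: "c * norm v \<le> (\<Sum>i<m. \<bar>gradient (F i) y \<bullet> v\<bar>) + \<bar>X y \<bullet> v\<bar>" if "y \<in> G" for y v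
  proof (cases "v = 0")
    case False
    then have "c \<le> \<Phi> (y, v /\<^sub>R norm v)" using that q by (simp add: c_def)
    also have "\<dots> = ((\<Sum>i<m. \<bar>gradient (F i) y \<bullet> v\<bar>) + \<bar>X y \<bullet> v\<bar>) / norm v"
      by (simp add: \<Phi>_def abs_mult divide_inverse distrib_left mult.commute flip: sum_distrib_left)
    finally show ?thesis using False by (simp add: pos_le_divide_eq)
  qed simp
  define e where "e = c / (2 * (real m + 1))"
  have e: "e > 0" "real m * e \<le> c / 2" using \<open>c > 0\<close> by (auto simp: e_def field_simps)
  have "\<forall>\<^sub>F r in at_right 0. \<forall>i\<in>{..<m}. \<forall>y\<in>G. \<forall>x\<in>cball y r.
      norm (F i x - F i y - frechet_derivative (F i) (at y) (x - y)) \<le> e * norm (x - y)"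
    using C1_uniform_linearization[OF U G F e(1)] by (intro eventually_ball_finite) auto
  then have "\<forall>\<^sub>F r in at_right 0. \<forall>y\<in>G. \<forall>x\<in>cball y r. (x - y) \<bullet> X y = 0 \<longrightarrow>
      c / 2 * norm (x - y) \<le> (\<Sum>i<m. \<bar>F i x\<bar>)"
  proof eventually_elim
    case (elim r)
    show ?case
    proof (intro ballI impI)
      fix y x assume yx: "y \<in> G" "x \<in> cball y r" "(x - y) \<bullet> X y = 0"
      have "\<bar>gradient (F i) y \<bullet> (x - y)\<bar> \<le> \<bar>F i x\<bar> + e * norm (x - y)" if "i < m" for i
      proof -
        have "F i differentiable (at y)" using F[OF that] yx G by auto
        then have "frechet_derivative (F i) (at y) (x - y) = gradient (F i) y \<bullet> (x - y)"
          by (rule gradient_works(3))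
        moreover have "norm (F i x - F i y - frechet_derivative (F i) (at y) (x - y)) \<le> e * norm (x - y)"
          using elim yx that by blast
        ultimately have "\<bar>F i x - gradient (F i) y \<bullet> (x - y)\<bar> \<le> e * norm (x - y)"
          using zero[OF that yx(1)] by simp
        then show ?thesis by linarith
      qed
      then have "(\<Sum>i<m. \<bar>gradient (F i) y \<bullet> (x - y)\<bar>) \<le> (\<Sum>i<m. \<bar>F i x\<bar> + e * norm (x - y))"
        by (intro sum_mono) auto
      also have "\<dots> = (\<Sum>i<m. \<bar>F i x\<bar>) + real m * e * norm (x - y)" by (simp add: sum.distrib)
      also have "\<dots> \<le> (\<Sum>i<m. \<bar>F i x\<bar>) + c / 2 * norm (x - y)"
        using e by (intro add_left_mono mult_right_mono) auto
      finally show "c / 2 * norm (x - y) \<le> (\<Sum>i<m. \<bar>F i x\<bar>)"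
        using bound[OF yx(1), of "x - y"] yx(3) by (simp add: inner_commute field_simps)
    qed
  qed
  then show ?thesis using that[of "c / 2"] \<open>c > 0\<close> by simp
qed

lemma smooth_on_C1: "smooth_on U f \<Longrightarrow> Ck_on (Suc 0) f U"
  unfolding smooth_on_def by blast

lemma smooth_on_continuous: "smooth_on U f \<Longrightarrow> continuous_on U f"
  unfolding smooth_on_def by (metis Ck_on.simps(1))

lemma smooth_on_differentiable: "smooth_on U f \<Longrightarrow> x \<in> U \<Longrightarrow> f differentiable (at x)"
  using smooth_on_C1[of U f] by simp


section \<open>One period near the orbit\<close>

context orbit_tube
begin

abbreviation "orbit \<equiv> \<gamma> ` {0..T}"

lemma orbit_continuous: "continuous_on S \<gamma>"
  using orbit_derivative by (intro continuous_on_vector_derivative)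

lemma orbit_compact: "compact orbit"
  by (intro compact_continuous_image orbit_continuous compact_Icc)

lemma orbit_nonempty: "orbit \<noteq> {}" using T_pos by auto

lemma orbit_subset: "orbit \<subseteq> U"
proof
  fix y assume "y \<in> orbit"
  then obtain t where "y = \<gamma> t" by blast
  then show "y \<in> U" using tube[of t] r_pos by auto
qed

text \<open>The orthogonality is the vanishing of the derivative of the squared distance at its minimum. It holds
also for \<open>\<theta> = 0\<close> and \<open>\<theta> = T\<close>, because by periodicity \<open>\<theta>\<close> minimizes over all of \<open>\<real>\<close>.\<close>

lemma nearest_phase:
  obtains \<theta> where "\<theta> \<in> {0..T}" "infdist x orbit = dist x (\<gamma> \<theta>)" "(x - \<gamma> \<theta>) \<bullet> X (\<gamma> \<theta>) = 0"
proof -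
  obtain \<theta> where \<theta>: "\<theta> \<in> {0..T}" "infdist x orbit = dist x (\<gamma> \<theta>)"
    using infdist_attains_inf[of orbit x] orbit_compact orbit_nonempty compact_imp_closed by blast
  let ?\<phi> = "\<lambda>t. (x - \<gamma> t) \<bullet> (x - \<gamma> t)"
  have d: "((\<lambda>t. x - \<gamma> t) has_vector_derivative (0 - X (\<gamma> \<theta>))) (at \<theta>)"
    by (intro has_vector_derivative_diff has_vector_derivative_const orbit_derivative)
  have "(?\<phi> has_real_derivative - 2 * ((x - \<gamma> \<theta>) \<bullet> X (\<gamma> \<theta>))) (at \<theta>)"
    using bounded_bilinear.has_vector_derivative[OF bounded_bilinear_inner d d]
    by (simp add: has_real_derivative_iff_has_vector_derivative inner_commute)
  moreover have "?\<phi> \<theta> \<le> ?\<phi> t" for t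
  proof -
    have "dist x (\<gamma> \<theta>) \<le> dist x (\<gamma> t)" using \<theta> infdist_le[OF orbit_mem] by metis
    then show ?thesis by (simp add: dist_norm norm_le)
  qed
  ultimately have "- 2 * ((x - \<gamma> \<theta>) \<bullet> X (\<gamma> \<theta>)) = 0"
    by (intro DERIV_local_min[of ?\<phi> _ \<theta> 1]) auto
  then show ?thesis using that \<theta> by simp
qed

text \<open>If \<open>h\<close> differs by at most \<open>\<eta>\<close> along \<open>x\<close> and along the orbit, then the logarithmic derivative of
\<open>D (x t)\<close> lies within \<open>\<eta>\<close> of \<open>h (\<gamma> (\<theta> + t - a))\<close>, whose integral over a period is independent of the phase.\<close>

lemma multiplier_bounds:
  fixes D h :: "'a \<Rightarrow> real"
  assumes D: "\<And>y. y \<in> U \<Longrightarrow> D differentiable (at y)"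
    and lie: "\<And>y. y \<in> U \<Longrightarrow> lie_derivative X D y = h y * D y"
    and h: "continuous_on U h"
    and \<theta>: "\<theta> \<in> {0..T}"
    and sol: "solution_on U X {a..a + T} x"
    and close: "\<And>t. t \<in> {a..a + T} \<Longrightarrow> \<bar>h (x t) - h (\<gamma> (\<theta> + t - a))\<bar> \<le> \<eta>"
  shows "\<bar>D (x (a + T))\<bar> \<le> \<bar>D (x a)\<bar> * exp (integral {0..T} (\<lambda>s. h (\<gamma> s)) + \<eta> * T)"
    and "\<bar>D (x a)\<bar> * exp (integral {0..T} (\<lambda>s. h (\<gamma> s)) - \<eta> * T) \<le> \<bar>D (x (a + T))\<bar>"
proof -
  have "continuous_on UNIV (\<lambda>s. h (\<gamma> s))"
    using orbit_mem orbit_subset by (intro continuous_on_compose2[OF h orbit_continuous]) blast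
  then obtain H where H:
    "\<And>t. t \<in> {\<theta>..\<theta> + T} \<Longrightarrow> (H has_real_derivative h (\<gamma> t)) (at t within {\<theta>..\<theta> + T})"
    "H (\<theta> + T) - H \<theta> = integral {0..T} (\<lambda>s. h (\<gamma> s))"
    using periodic_antiderivative[of "\<lambda>s. h (\<gamma> s)" T \<theta>] orbit_period \<theta> by auto
  have G: "((\<lambda>t. H (\<theta> + t - a) + m * t) has_real_derivative h (\<gamma> (\<theta> + t - a)) + m) (at t within {a..a + T})"
    if t: "t \<in> {a..a + T}" for t m
  proof -
    have shift: "((\<lambda>t. \<theta> + t - a) has_real_derivative 1) (at t within {a..a + T})"
      by (auto intro!: derivative_eq_intros)
    have H': "(H has_real_derivative h (\<gamma> (\<theta> + t - a)))
        (at (\<theta> + t - a) within (\<lambda>t. \<theta> + t - a) ` {a..a + T})"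
      using t by (intro DERIV_subset[OF H(1)]) auto
    have "((\<lambda>t. H (\<theta> + t - a)) has_real_derivative h (\<gamma> (\<theta> + t - a)) * 1) (at t within {a..a + T})"
      using DERIV_image_chain[OF H' shift] by (simp add: o_def)
    then show ?thesis by (auto intro!: derivative_eq_intros)
  qed
  have z: "((\<lambda>t. D (x t)) has_vector_derivative h (x t) * D (x t)) (at t within {a..a + T})"
    if "t \<in> {a..a + T}" for t
  proof -
    have "x t \<in> U" "(x has_vector_derivative X (x t)) (at t within {a..a + T})"
      using sol that by (auto simp: solution_on_def)
    then show ?thesis
      using lie_derivative_along_solution[of D x t X "{a..a + T}"] D lie
      by (simp add: has_real_derivative_iff_has_vector_derivative)
  qed
  have "norm (D (x (a + T))) \<le> norm (D (x a)) *
      exp ((H (\<theta> + (a + T) - a) + \<eta> * (a + T)) - (H (\<theta> + a - a) + \<eta> * a))"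
  proof (rule linear_growth_upper[OF _ z G])
    fix t assume t: "t \<in> {a..a + T}"
    have "h (x t) * (D (x t))\<^sup>2 \<le> (h (\<gamma> (\<theta> + t - a)) + \<eta>) * (D (x t))\<^sup>2"
      using close[OF t] by (intro mult_right_mono) auto
    then show "(h (x t) * D (x t)) \<bullet> D (x t) \<le> (h (\<gamma> (\<theta> + t - a)) + \<eta>) * (norm (D (x t)))\<^sup>2"
      by (simp add: power2_eq_square mult.assoc)
  qed (use T_pos in auto)
  then show "\<bar>D (x (a + T))\<bar> \<le> \<bar>D (x a)\<bar> * exp (integral {0..T} (\<lambda>s. h (\<gamma> s)) + \<eta> * T)"
    by (simp add: H(2)[symmetric] algebra_simps)
  have "norm (D (x a)) *
      exp ((H (\<theta> + (a + T) - a) + (- \<eta>) * (a + T)) - (H (\<theta> + a - a) + (- \<eta>) * a)) \<le> norm (D (x (a + T)))"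
  proof (rule linear_growth_lower[OF _ z G])
    fix t assume t: "t \<in> {a..a + T}"
    have "(h (\<gamma> (\<theta> + t - a)) + - \<eta>) * (D (x t))\<^sup>2 \<le> h (x t) * (D (x t))\<^sup>2"
      using close[OF t] by (intro mult_right_mono) auto
    then show "(h (\<gamma> (\<theta> + t - a)) + - \<eta>) * (norm (D (x t)))\<^sup>2 \<le> (h (x t) * D (x t)) \<bullet> D (x t)"
      by (simp add: power2_eq_square mult.assoc)
  qed (use T_pos in auto)
  then show "\<bar>D (x a)\<bar> * exp (integral {0..T} (\<lambda>s. h (\<gamma> s)) - \<eta> * T) \<le> \<bar>D (x (a + T))\<bar>"
    by (simp add: H(2)[symmetric] algebra_simps)
qed

lemma period_floor:
  assumes "t \<ge> 0"
  obtains n :: nat where "real n * T \<le> t" "t < real n * T + T"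
proof -
  have "real (nat \<lfloor>t / T\<rfloor>) \<le> t / T" "t / T < real (nat \<lfloor>t / T\<rfloor>) + 1"
    using assms T_pos by (auto simp: of_nat_nat)
  then show ?thesis using that[of "nat \<lfloor>t / T\<rfloor>"] T_pos by (simp add: field_simps)
qed

text \<open>From \<open>\<gamma> 0\<close> a short step in the direction of the gradient makes \<open>D\<close> positive.\<close>

lemma exists_point_off_zero_set:
  fixes D :: "'a \<Rightarrow> real"
  assumes U: "open U" and D: "D differentiable (at (\<gamma> 0))" "D (\<gamma> 0) = 0" "gradient D (\<gamma> 0) \<noteq> 0"
    and "\<delta> > 0"
  shows "\<exists>x\<in>U. infdist x orbit < \<delta> \<and> \<bar>D x\<bar> > 0"
proof -
  define g where "g = gradient D (\<gamma> 0)"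
  obtain \<rho> where \<rho>: "\<rho> > 0" "ball (\<gamma> 0) \<rho> \<subseteq> U"
    using U orbit_mem orbit_subset openE by blast
  have "((\<lambda>s. \<gamma> 0 + s *\<^sub>R g) has_vector_derivative g) (at 0)"
    by (auto intro!: derivative_eq_intros)
  moreover have "(D has_derivative (\<lambda>v. v \<bullet> g)) (at (\<gamma> 0 + 0 *\<^sub>R g) within (\<lambda>s. \<gamma> 0 + s *\<^sub>R g) ` UNIV)"
    using gradient_works(1)[OF D(1)] by (simp add: gderiv_def g_def has_derivative_at_withinI)
  ultimately have "((\<lambda>s. D (\<gamma> 0 + s *\<^sub>R g)) has_real_derivative g \<bullet> g) (at 0)"
    using vector_derivative_diff_chain_within[of "\<lambda>s. \<gamma> 0 + s *\<^sub>R g" g 0 UNIV D]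
    by (simp add: o_def has_real_derivative_iff_has_vector_derivative)
  moreover have "g \<bullet> g > 0" using D(3) by (simp add: g_def)
  ultimately obtain d where d: "d > 0" "\<And>s. 0 < s \<Longrightarrow> s < d \<Longrightarrow> D (\<gamma> 0) < D (\<gamma> 0 + s *\<^sub>R g)"
    using DERIV_pos_inc_right[of "\<lambda>s. D (\<gamma> 0 + s *\<^sub>R g)" "g \<bullet> g" 0] by auto
  have g: "norm g > 0" using D(3) by (simp add: g_def)
  define w where "w = min \<delta> \<rho> / norm g"
  define s where "s = min d w / 2"
  have s: "0 < s" "s < d" "s * norm g < min \<delta> \<rho>"
  proof -
    have pos: "0 < w" using \<rho> \<open>\<delta> > 0\<close> g by (simp add: w_def)
    then show "0 < s" "s < d" using d by (auto simp: s_def)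
    have "s < w" using pos by (auto simp: s_def)
    then show "s * norm g < min \<delta> \<rho>" using g by (simp add: w_def pos_less_divide_eq)
  qed
  let ?x = "\<gamma> 0 + s *\<^sub>R g"
  have "dist ?x (\<gamma> 0) < min \<delta> \<rho>" using s by (simp add: dist_norm)
  then have "?x \<in> U" "infdist ?x orbit < \<delta>"
    using \<rho> infdist_le[OF orbit_mem, of ?x 0] by (auto simp: dist_commute)
  moreover have "\<bar>D ?x\<bar> > 0" using d(2)[OF s(1,2)] D(2) by simp
  ultimately show ?thesis by blast
qed

section \<open>Criteria for instability and for asymptotic stability with phase\<close>

text \<open>The neighbourhood tested for stability has radius \<open>r / exp (L T)\<close>: a solution confined to it is, at
the beginning of each period, so close to some \<open>\<gamma> \<theta>\<close> that it shadows \<open>\<gamma> (\<theta> + \<cdot>)\<close> within \<open>r\<close> during the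
whole period. Then \<open>V\<close> grows geometrically, contrary to its boundedness.\<close>

lemma unstable_of_expansion:
  fixes V :: "'a \<Rightarrow> real"
  assumes expansion: "\<And>x a \<theta>. \<theta> \<in> {0..T} \<Longrightarrow> solution_on U X {a..a + T} x \<Longrightarrow>
        (\<And>t. t \<in> {a..a + T} \<Longrightarrow> dist (x t) (\<gamma> (\<theta> + t - a)) \<le> r) \<Longrightarrow> q * V (x a) \<le> V (x (a + T))"
    and q: "q > 1"
    and bounded: "\<And>x. infdist x orbit \<le> r \<Longrightarrow> V x \<le> C"
    and near: "\<And>\<delta>. \<delta> > 0 \<Longrightarrow> \<exists>x\<in>U. infdist x orbit < \<delta> \<and> V x > 0"
  shows "orbitally_unstable U X orbit"
  unfolding orbitally_unstable_def
proof
  assume stable: "orbitally_stable U X U orbit"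
  define K where "K = exp (L * T)"
  have K: "K \<ge> 1" using L_pos T_pos by (simp add: K_def)
  have "r / K > 0" using r_pos K by simp
  then obtain \<delta> where \<delta>: "\<delta> > 0" "\<And>x0. x0 \<in> U \<Longrightarrow> infdist x0 orbit < \<delta> \<Longrightarrow>
      \<exists>x. forward_solution U X x0 x \<and> (\<forall>t>0. infdist (x t) orbit < r / K)"
    using stable unfolding orbitally_stable_def by metis
  obtain x0 where x0: "x0 \<in> U" "infdist x0 orbit < min \<delta> (r / K)" "V x0 > 0"
    using near[of "min \<delta> (r / K)"] \<delta> \<open>r / K > 0\<close> by auto
  then obtain x where x: "solution_on U X {0..} x" "x 0 = x0" "\<And>t. t > 0 \<Longrightarrow> infdist (x t) orbit < r / K"
    using \<delta>(2)[of x0] by (auto simp: forward_solution_def)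
  have close: "infdist (x t) orbit < r / K" if "t \<ge> 0" for t
    using x x0 that by (cases "t = 0") auto
  have growth: "q ^ n * V x0 \<le> V (x (real n * T))" for n
  proof (induction n)
    case 0
    then show ?case using x by simp
  next
    case (Suc n)
    let ?a = "real n * T"
    have "?a \<ge> 0" using T_pos by simp
    obtain \<theta> where \<theta>: "\<theta> \<in> {0..T}" "infdist (x ?a) orbit = dist (x ?a) (\<gamma> \<theta>)"
      using nearest_phase by metis
    have small: "dist (x ?a) (\<gamma> \<theta>) * K < r"
      using close[OF \<open>?a \<ge> 0\<close>] \<theta> K by (simp add: field_simps)
    have sol: "solution_on U X {?a..?a + T} x"
      unfolding solution_on_def
    proof
      fix t assume "t \<in> {?a..?a + T}"
      then have t: "t \<in> {?a..?a + T}" "t \<ge> 0"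
        using order_trans[OF \<open>?a \<ge> 0\<close>, of t] by auto
      then have "x t \<in> U" "(x has_vector_derivative X (x t)) (at t within {0..})"
        using x(1) by (auto simp: solution_on_def)
      moreover have "{?a..?a + T} \<subseteq> {0..}" using \<open>?a \<ge> 0\<close> by auto
      ultimately show "x t \<in> U \<and> (x has_vector_derivative X (x t)) (at t within {?a..?a + T})"
        using has_vector_derivative_within_subset by blast
    qed
    have "q * V (x ?a) \<le> V (x (?a + T))"
    proof (rule expansion[OF \<theta>(1) sol])
      fix t assume t: "t \<in> {?a..?a + T}"
      have "dist (x t) (\<gamma> (\<theta> + t - ?a)) \<le> dist (x ?a) (\<gamma> \<theta>) * exp (L * (t - ?a))"
        by (rule shadowing[of ?a "?a + T" x "\<lambda>t. X (x t)"])
           (use sol small t in \<open>auto simp: solution_on_def K_def\<close>)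
      also have "\<dots> \<le> dist (x ?a) (\<gamma> \<theta>) * K"
        using t L_pos unfolding K_def by (intro mult_left_mono) auto
      finally show "dist (x t) (\<gamma> (\<theta> + t - ?a)) \<le> r" using small by simp
    qed
    moreover have "q * (q ^ n * V x0) \<le> q * V (x ?a)" using Suc q by (intro mult_left_mono) auto
    ultimately show ?case by (simp add: algebra_simps)
  qed
  obtain n where n: "C / V x0 < q ^ n" using real_arch_pow[OF q] by blast
  have "r / K \<le> r" using K r_pos by (simp add: divide_le_eq)
  then have "infdist (x (real n * T)) orbit \<le> r" using close[of "real n * T"] T_pos by simp
  then have "q ^ n * V x0 \<le> C" using growth[of n] bounded by (meson order_trans)
  then show False using n x0 by (simp add: field_simps)
qed

text \<open>Convergence with asymptotic phase implies that the distance to the orbit tends to \<open>0\<close>, so one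
quantitative attraction statement yields all three requirements.\<close>

lemma phase_asymptotically_stable_of_attraction:
  assumes "\<delta> > 0" "B > 0"
    and *: "\<And>x0. x0 \<in> M \<Longrightarrow> infdist x0 orbit < \<delta> \<Longrightarrow> \<exists>x \<theta>. forward_solution U X x0 x \<and>
       (\<forall>t\<ge>0. infdist (x t) orbit \<le> B * infdist x0 orbit) \<and>
       ((\<lambda>t. norm (x t - \<gamma> (t + \<theta>))) \<longlongrightarrow> 0) at_top"
  shows "orbitally_phase_asymptotically_stable U X M T \<gamma>"
  unfolding orbitally_phase_asymptotically_stable_def orbitally_asymptotically_stable_def orbitally_stable_def
proof (intro conjI allI impI)
  fix \<epsilon> :: real assume "\<epsilon> > 0"
  show "\<exists>\<delta>>0. \<forall>x0\<in>M. infdist x0 orbit < \<delta> \<longrightarrow>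
      (\<exists>x. forward_solution U X x0 x \<and> (\<forall>t>0. infdist (x t) orbit < \<epsilon>))"
  proof (intro exI[of _ "min \<delta> (\<epsilon> / B)"] conjI ballI impI)
    fix x0 assume x0: "x0 \<in> M" "infdist x0 orbit < min \<delta> (\<epsilon> / B)"
    then obtain x where x: "forward_solution U X x0 x"
      "\<And>t. t \<ge> 0 \<Longrightarrow> infdist (x t) orbit \<le> B * infdist x0 orbit"
      using *[of x0] by auto
    have "B * infdist x0 orbit < \<epsilon>" using x0 \<open>B > 0\<close> by (simp add: field_simps)
    then have "\<forall>t>0. infdist (x t) orbit < \<epsilon>" using x(2) by (meson less_imp_le order.strict_trans1)
    with x(1) show "\<exists>x. forward_solution U X x0 x \<and> (\<forall>t>0. infdist (x t) orbit < \<epsilon>)" by blast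
  qed (use \<open>\<epsilon> > 0\<close> assms in auto)
next
  have conv: "((\<lambda>t. infdist (x t) orbit) \<longlongrightarrow> 0) at_top"
    if "((\<lambda>t. norm (x t - \<gamma> (t + \<theta>))) \<longlongrightarrow> 0) at_top" for x \<theta>
    using that
  proof (rule tendsto_sandwich[where f = "\<lambda>_. 0", rotated 3])
    show "\<forall>\<^sub>F t in at_top. infdist (x t) orbit \<le> norm (x t - \<gamma> (t + \<theta>))"
      using infdist_le[OF orbit_mem] by (simp add: dist_norm)
  qed (auto simp: infdist_nonneg)
  show "\<exists>\<delta>>0. \<forall>x0\<in>M. infdist x0 orbit < \<delta> \<longrightarrow>
      (\<exists>x. forward_solution U X x0 x \<and> ((\<lambda>t. infdist (x t) orbit) \<longlongrightarrow> 0) at_top)"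
    using assms(1) * conv by metis
  show "\<exists>\<delta>>0. \<forall>x0\<in>M. infdist x0 orbit < \<delta> \<longrightarrow> (\<exists>x. forward_solution U X x0 x \<and>
      (\<exists>\<theta>0. ((\<lambda>t. norm (x t - \<gamma> (t + \<theta>0))) \<longlongrightarrow> 0) at_top))"
    using assms(1) * by metis
qed

text \<open>A function \<open>V\<close> comparable with the distance to the orbit and contracted in every period forces the
return points \<open>x (n T)\<close> to have summable displacements. This bounds the drift of the phase, so the
solution stays in a tube around one fixed translate \<open>\<gamma> (\<theta> + \<cdot>)\<close>, and it makes the return points converge;
their limit determines the asymptotic phase.\<close>

lemma phase_asymptotically_stable_of_contraction:
  fixes V :: "'a \<Rightarrow> real"
  assumes c: "c > 0" and lower: "\<And>x. x \<in> M \<Longrightarrow> infdist x orbit \<le> r \<Longrightarrow> c * infdist x orbit \<le> V x"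
    and C: "C \<ge> 0" and upper: "\<And>x. x \<in> M \<Longrightarrow> infdist x orbit \<le> r \<Longrightarrow> V x \<le> C * infdist x orbit"
    and contraction: "\<And>x a \<theta>. \<theta> \<in> {0..T} \<Longrightarrow> solution_on U X {a..a + T} x \<Longrightarrow> x a \<in> M \<Longrightarrow>
        (\<And>t. t \<in> {a..a + T} \<Longrightarrow> dist (x t) (\<gamma> (\<theta> + t - a)) \<le> r) \<Longrightarrow>
        x (a + T) \<in> M \<and> V (x (a + T)) \<le> q * V (x a)"
    and q: "0 \<le> q" "q < 1"
  shows "orbitally_phase_asymptotically_stable U X M T \<gamma>"
proof -
  define K where "K = exp (L * T)"
  have K: "K \<ge> 1" using L_pos T_pos by (simp add: K_def)
  have K_ge: "exp (L * (t - a)) \<le> K" if "t \<in> {a..a + T}" for t a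
    using that L_pos by (simp add: K_def)
  \<comment> \<open>If \<open>d\<close> is the initial distance, \<open>A d q\<^sup>n\<close> will bound the displacement in the \<open>n\<close>-th period; summing
    the geometric series gives \<open>(1 + A / (1 - q)) d\<close> as bound at all return times, and one more
    factor \<open>K\<close> covers the times in between.\<close>
  define A where "A = (K + 1) * C / c"
  have A: "A \<ge> 0" using K C c by (simp add: A_def)
  define B where "B = K * (1 + A / (1 - q))"
  have B: "B > 0" using K A q by (simp add: B_def add_pos_nonneg)
  have "\<exists>x \<theta>. forward_solution U X x0 x \<and>
       (\<forall>t\<ge>0. infdist (x t) orbit \<le> B * infdist x0 orbit) \<and>
       ((\<lambda>t. norm (x t - \<gamma> (t + \<theta>))) \<longlongrightarrow> 0) at_top"
    if x0: "x0 \<in> M" "infdist x0 orbit < r / B" for x0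
  proof -
    define d where "d = infdist x0 orbit"
    have d: "d \<ge> 0" "B * d < r" using x0 B by (auto simp: d_def infdist_nonneg field_simps)
    obtain \<theta> where \<theta>: "\<theta> \<in> {0..T}" "dist x0 (\<gamma> \<theta>) = d" using nearest_phase d_def by metis
    obtain x f where x: "x 0 = x0"
      "\<And>t. t \<ge> 0 \<Longrightarrow> (x has_vector_derivative f t) (at t within {0..})"
      "\<And>t. t \<ge> 0 \<Longrightarrow> dist (x t) (\<gamma> (\<theta> + t)) \<le> r \<Longrightarrow> f t = X (x t)"
      using cutoff_solution[of x0 \<theta>] by blast
    define \<tau> where "\<tau> n = real n * T" for n
    have \<tau>: "\<tau> n \<ge> 0" "\<tau> (Suc n) = \<tau> n + T" "\<tau> 0 = 0" for n
      using T_pos by (auto simp: \<tau>_def algebra_simps)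
    have \<gamma>_\<tau>: "\<gamma> (s + t - \<tau> n) = \<gamma> (s + t)" for s t n
      using orbit_period_nat[of "s + t - \<tau> n" n] by (simp add: \<tau>_def)
    have x_der: "(x has_vector_derivative f t) (at t within {\<tau> n..\<tau> n + T})"
      if "t \<in> {\<tau> n..\<tau> n + T}" for t n
      using that \<tau>(1)[of n] by (intro has_vector_derivative_within_subset[OF x(2)]) auto
    have near: "dist (x t) (\<gamma> (\<theta> + t - \<tau> n)) \<le> dist (x (\<tau> n)) (\<gamma> \<theta>) * K"
      if small: "dist (x (\<tau> n)) (\<gamma> \<theta>) * K < r" and t: "t \<in> {\<tau> n..\<tau> n + T}" for n t
    proof -
      have "dist (x t) (\<gamma> (\<theta> + t - \<tau> n)) \<le> dist (x (\<tau> n)) (\<gamma> \<theta>) * exp (L * (t - \<tau> n))"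
      proof (rule shadowing[OF x_der])
        fix s assume "s \<in> {\<tau> n..\<tau> n + T}" "dist (x s) (\<gamma> (\<theta> + s - \<tau> n)) \<le> r"
        then show "f s = X (x s)" using x(3)[of s] \<tau>(1)[of n] by (simp add: \<gamma>_\<tau>)
      qed (use small t in \<open>auto simp: K_def\<close>)
      also have "\<dots> \<le> dist (x (\<tau> n)) (\<gamma> \<theta>) * K"
        using K_ge[OF t] by (intro mult_left_mono) auto
      finally show ?thesis .
    qed
    have sol: "solution_on U X {\<tau> n..\<tau> n + T} x"
      if small: "dist (x (\<tau> n)) (\<gamma> \<theta>) * K < r" for n
      unfolding solution_on_def
    proof
      fix t assume t: "t \<in> {\<tau> n..\<tau> n + T}"
      have le: "dist (x t) (\<gamma> (\<theta> + t)) \<le> r" using near[OF small t] small by (simp add: \<gamma>_\<tau>)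
      then have "x t \<in> U" using tube[of "\<theta> + t"] by (auto simp: dist_commute)
      moreover have "f t = X (x t)" using x(3)[OF _ le] t \<tau>(1)[of n] by auto
      ultimately show "x t \<in> U \<and> (x has_vector_derivative X (x t)) (at t within {\<tau> n..\<tau> n + T})"
        using x_der[OF t] by simp
    qed
    \<comment> \<open>The invariant of the induction over the periods. Its last part, relative to the initial phase \<open>\<theta>\<close>,
      keeps the solution in the tube; its second part makes the distances decay.\<close>
    define P where "P n \<longleftrightarrow> x (\<tau> n) \<in> M \<and> V (x (\<tau> n)) \<le> q ^ n * V x0 \<and>
        dist (x (\<tau> n)) (\<gamma> \<theta>) \<le> d + A * d * (\<Sum>k<n. q ^ k)" for n
    have P_small: "dist (x (\<tau> n)) (\<gamma> \<theta>) * K \<le> B * d" if "P n" for n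
    proof -
      have "(\<Sum>k<n. q ^ k) \<le> 1 / (1 - q)"
        using q by (simp add: sum_gp_strict divide_right_mono)
      then have "A * d * (\<Sum>k<n. q ^ k) \<le> A * d * (1 / (1 - q))"
        using A d by (intro mult_left_mono) auto
      then have "dist (x (\<tau> n)) (\<gamma> \<theta>) \<le> d + A * d * (1 / (1 - q))"
        using that by (simp add: P_def)
      then have "dist (x (\<tau> n)) (\<gamma> \<theta>) * K \<le> (d + A * d * (1 / (1 - q))) * K"
        using K by (intro mult_right_mono) auto
      then show ?thesis by (simp add: B_def algebra_simps)
    qed
    have V0: "V x0 \<le> C * d"
    proof -
      have "B \<ge> 1" using mult_mono[of 1 K 1 "1 + A / (1 - q)"] K A q by (simp add: B_def)
      then have "d \<le> r" using d mult_right_mono[of 1 B d] by simp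
      then show ?thesis using upper x0 by (simp add: d_def)
    qed
    have drift: "infdist (x (\<tau> n)) orbit \<le> C * d / c * q ^ n"
      "dist (x (\<tau> (Suc n))) (x (\<tau> n)) \<le> A * d * q ^ n" if "P n" for n
    proof -
      have small: "dist (x (\<tau> n)) (\<gamma> \<theta>) * K < r" using P_small[OF that] d by simp
      \<comment> \<open>Relative to the nearest phase \<open>\<phi>\<close>, rather than to \<open>\<theta>\<close>, the solution starts at a distance of order
        \<open>q\<^sup>n\<close>. Since \<open>\<gamma> \<phi>\<close> returns to itself, both ends of the period are close to it.\<close>
      obtain \<phi> where \<phi>: "\<phi> \<in> {0..T}" "infdist (x (\<tau> n)) orbit = dist (x (\<tau> n)) (\<gamma> \<phi>)"
        using nearest_phase by metis
      define e where "e = dist (x (\<tau> n)) (\<gamma> \<phi>)"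
      have "e \<le> dist (x (\<tau> n)) (\<gamma> \<theta>)" using \<phi> infdist_le[OF orbit_mem] e_def by metis
      then have eK: "e * K < r" using small K mult_right_mono[of e "dist (x (\<tau> n)) (\<gamma> \<theta>)" K] by linarith
      then have "e \<le> r" using K mult_left_mono[of 1 K e] by (simp add: e_def)
      then have "c * e \<le> V (x (\<tau> n))" using lower[of "x (\<tau> n)"] \<phi> that by (simp add: P_def e_def)
      also have "\<dots> \<le> q ^ n * V x0" using that by (simp add: P_def)
      also have "\<dots> \<le> q ^ n * (C * d)" using V0 q by (intro mult_left_mono) auto
      finally have "e \<le> q ^ n * (C * d) / c" using c by (simp add: pos_le_divide_eq mult.commute)
      then have e: "e \<le> C * d / c * q ^ n" by (simp add: mult.commute)
      then show "infdist (x (\<tau> n)) orbit \<le> C * d / c * q ^ n" using \<phi> by (simp add: e_def)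
      have "dist (x (\<tau> n + T)) (\<gamma> (\<phi> + (\<tau> n + T) - \<tau> n)) \<le> e * exp (L * (\<tau> n + T - \<tau> n))"
        unfolding e_def
        by (rule shadowing[of "\<tau> n" "\<tau> n + T" x "\<lambda>t. X (x t)"])
           (use sol[OF small] eK T_pos in \<open>auto simp: solution_on_def K_def e_def\<close>)
      then have "dist (x (\<tau> (Suc n))) (\<gamma> \<phi>) \<le> e * K"
        using orbit_period[of \<phi>] by (simp add: \<tau> K_def)
      then have "dist (x (\<tau> (Suc n))) (x (\<tau> n)) \<le> (K + 1) * e"
        using dist_triangle2[of "x (\<tau> (Suc n))" "x (\<tau> n)" "\<gamma> \<phi>"] by (simp add: e_def algebra_simps)
      also have "\<dots> \<le> (K + 1) * (C * d / c * q ^ n)" using e K by (intro mult_left_mono) auto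
      finally show "dist (x (\<tau> (Suc n))) (x (\<tau> n)) \<le> A * d * q ^ n" by (simp add: A_def)
    qed
    have P: "P n" for n
    proof (induction n)
      case 0
      then show ?case using x0 x \<theta> by (simp add: P_def \<tau>)
    next
      case (Suc n)
      have small: "dist (x (\<tau> n)) (\<gamma> \<theta>) * K < r" using P_small[OF Suc] d by simp
      have "x (\<tau> n + T) \<in> M \<and> V (x (\<tau> n + T)) \<le> q * V (x (\<tau> n))"
      proof (rule contraction[OF \<theta>(1) sol[OF small]])
        show "x (\<tau> n) \<in> M" using Suc by (simp add: P_def)
        show "dist (x t) (\<gamma> (\<theta> + t - \<tau> n)) \<le> r" if "t \<in> {\<tau> n..\<tau> n + T}" for t
          using near[OF small that] small by simp
      qed
      moreover have "q * V (x (\<tau> n)) \<le> q * (q ^ n * V x0)"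
        using Suc q by (intro mult_left_mono) (auto simp: P_def)
      moreover have "dist (x (\<tau> (Suc n))) (\<gamma> \<theta>) \<le> d + A * d * (\<Sum>k<Suc n. q ^ k)"
        using drift(2)[OF Suc] dist_triangle[of "x (\<tau> (Suc n))" "\<gamma> \<theta>" "x (\<tau> n)"] Suc
        by (simp add: P_def algebra_simps)
      ultimately show ?case by (simp add: P_def \<tau>(2) mult.assoc)
    qed
    have small: "dist (x (\<tau> n)) (\<gamma> \<theta>) * K < r" for n using P_small[OF P] d order.strict_trans1 by blast
    have stay: "dist (x t) (\<gamma> (\<theta> + t)) \<le> B * d" if t: "t \<ge> 0" for t
    proof -
      obtain n where "real n * T \<le> t" "t < real n * T + T" using period_floor[OF t] by blast
      then have "t \<in> {\<tau> n..\<tau> n + T}" by (simp add: \<tau>_def)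
      from near[OF small this] show ?thesis using P_small[OF P, of n] by (simp add: \<gamma>_\<tau>)
    qed
    have fwd: "forward_solution U X x0 x"
      unfolding forward_solution_def solution_on_def
    proof (intro conjI ballI)
      fix t :: real assume "t \<in> {0..}"
      then have t: "t \<ge> 0" by simp
      have le: "dist (x t) (\<gamma> (\<theta> + t)) \<le> r" using stay[OF t] d by simp
      then show "x t \<in> U" using tube[of "\<theta> + t"] by (auto simp: dist_commute)
      show "(x has_vector_derivative X (x t)) (at t within {0..})"
        using x(2)[OF t] x(3)[OF t le] by simp
    qed (fact x(1))
    have bound: "infdist (x t) orbit \<le> B * d" if "t \<ge> 0" for t
      using stay[OF that] infdist_le[OF orbit_mem, of "x t" "\<theta> + t"] by simp
    have geo: "summable (\<lambda>n. b * q ^ n)" for b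
      using q by (intro summable_mult summable_geometric) auto
    have "summable (\<lambda>n. x (\<tau> (Suc n)) - x (\<tau> n))"
      using drift(2)[OF P] by (intro summable_comparison_test'[OF geo, of 0]) (auto simp: dist_norm)
    then have "convergent (\<lambda>n. \<Sum>k<n. x (\<tau> (Suc k)) - x (\<tau> k))"
      by (simp add: summable_iff_convergent)
    then have "convergent (\<lambda>n. x (\<tau> n) - x (\<tau> 0))" by (simp only: sum_lessThan_telescope[of "\<lambda>n. x (\<tau> n)"])
    then obtain p' where "(\<lambda>n. x (\<tau> n) - x (\<tau> 0)) \<longlonglongrightarrow> p'" by (auto simp: convergent_def)
    from tendsto_add[OF this tendsto_const[of "x (\<tau> 0)"]]
    obtain p where p: "(\<lambda>n. x (\<tau> n)) \<longlonglongrightarrow> p" by auto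
    have "(\<lambda>n. infdist (x (\<tau> n)) orbit) \<longlonglongrightarrow> 0"
    proof (rule tendsto_sandwich[where f = "\<lambda>_. 0" and h = "\<lambda>n. C * d / c * q ^ n"])
      show "(\<lambda>n. C * d / c * q ^ n) \<longlonglongrightarrow> 0" using geo by (rule summable_LIMSEQ_zero)
    qed (use drift(1)[OF P] in \<open>auto simp: infdist_nonneg\<close>)
    moreover have "(\<lambda>n. infdist (x (\<tau> n)) orbit) \<longlonglongrightarrow> infdist p orbit"
      using p by (rule tendsto_infdist)
    ultimately have "infdist p orbit = 0" using LIMSEQ_unique by blast
    then have "p \<in> orbit"
      using in_closed_iff_infdist_zero[of orbit p] orbit_compact orbit_nonempty compact_imp_closed by blast
    then obtain \<psi> where \<psi>: "p = \<gamma> \<psi>" by blast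
    have "((\<lambda>t. norm (x t - \<gamma> (t + \<psi>))) \<longlongrightarrow> 0) at_top"
    proof (rule tendstoI)
      fix \<epsilon> :: real assume "\<epsilon> > 0"
      then have "min \<epsilon> r / K > 0" using r_pos K by simp
      then obtain N where N: "\<And>n. n \<ge> N \<Longrightarrow> dist (x (\<tau> n)) (\<gamma> \<psi>) < min \<epsilon> r / K"
        using p[unfolded \<psi> lim_sequentially] by meson
      show "\<forall>\<^sub>F t in at_top. dist (norm (x t - \<gamma> (t + \<psi>))) 0 < \<epsilon>"
      proof (rule eventually_at_top_linorderI[of "\<tau> N"])
        fix t assume t: "\<tau> N \<le> t"
        then have "t \<ge> 0" using \<tau>(1)[of N] by simp
        then obtain n where n: "\<tau> n \<le> t" "t < \<tau> n + T" using period_floor \<tau>_def by metis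
        then have "real N * T < (real n + 1) * T" using t by (simp add: \<tau>_def algebra_simps)
        then have "N \<le> n" using T_pos by simp
        then have nN: "dist (x (\<tau> n)) (\<gamma> \<psi>) * K < min \<epsilon> r" using N K by (simp add: field_simps)
        have "dist (x t) (\<gamma> (\<psi> + t - \<tau> n)) \<le> dist (x (\<tau> n)) (\<gamma> \<psi>) * exp (L * (t - \<tau> n))"
          by (rule shadowing[of "\<tau> n" "\<tau> n + T" x "\<lambda>t. X (x t)"])
             (use sol[OF small] nN n in \<open>auto simp: solution_on_def K_def\<close>)
        also have "\<dots> \<le> dist (x (\<tau> n)) (\<gamma> \<psi>) * K"
          using K_ge[of t "\<tau> n"] n by (intro mult_left_mono) auto
        finally have "dist (x t) (\<gamma> (\<psi> + t)) < \<epsilon>" using nN by (simp add: \<gamma>_\<tau>)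
        then show "dist (norm (x t - \<gamma> (t + \<psi>))) 0 < \<epsilon>" by (simp add: dist_norm add.commute)
      qed
    qed
    with fwd bound show ?thesis unfolding d_def by blast
  qed
  then show ?thesis
    using B r_pos by (intro phase_asymptotically_stable_of_attraction[of "r / B" B]) auto
qed

end

section \<open>Stability of periodic orbits of dissipative systems\<close>

theorem theorem4p3:
  fixes U :: "(real ^ 'n) set"
    and X :: "real ^ 'n \<Rightarrow> real ^ 'n"
    and k p :: nat
    and I D h :: "nat \<Rightarrow> real ^ 'n \<Rightarrow> real"
    and T :: real
    and \<gamma> :: "real \<Rightarrow> real ^ 'n"
    and \<Gamma> :: "(real ^ 'n) set"
  assumes "open U"
    and "smooth_on U X"
    and "codim_one_dissipative U X k p I D h"
    and "T_periodic_solution U X T \<gamma>"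
    and "\<Gamma> = \<gamma> ` {0..T}"
    and "\<Gamma> \<subseteq> zero_fibre U (k + p) (join_maps k I D)"
    and "regular_value U (k + p) (join_maps k I D) (\<lambda>_. 0)"
    and "\<And>t. 0 \<le> t \<Longrightarrow> t \<le> T \<Longrightarrow>
           independent_family
             (map (\<lambda>i. gradient (I i) (\<gamma> t)) [0..<k] @
              map (\<lambda>j. gradient (D j) (\<gamma> t)) [0..<p] @ [X (\<gamma> t)])"
  shows "(regular_value U k I (\<lambda>_. 0) \<and> (\<forall>j<p. integral {0..T} (\<lambda>s. h j (\<gamma> s)) < 0) \<longrightarrow>
           orbitally_phase_asymptotically_stable U X (zero_fibre U k I) T \<gamma>) \<and>
         ((\<exists>j<p. integral {0..T} (\<lambda>s. h j (\<gamma> s)) > 0) \<longrightarrow> orbitally_unstable U X \<Gamma>)"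
proof -
  note U = assms(1) and \<Gamma> = assms(5)
  let ?F = "join_maps k I D"
  let ?m = "\<lambda>j. integral {0..T} (\<lambda>s. h j (\<gamma> s))"
  have kp: "p > 0" "k + p = CARD('n) - 1"
    and I: "\<And>i. i < k \<Longrightarrow> smooth_on U (I i)" "\<And>i x. i < k \<Longrightarrow> x \<in> U \<Longrightarrow> lie_derivative X (I i) x = 0"
    and D: "\<And>j. j < p \<Longrightarrow> smooth_on U (D j)" "\<And>j. j < p \<Longrightarrow> smooth_on U (h j)"
      "\<And>j x. j < p \<Longrightarrow> x \<in> U \<Longrightarrow> lie_derivative X (D j) x = h j x * D j x"
    using assms(3) by (auto simp: codim_one_dissipative_def)
  have D_diff: "D j differentiable (at y)" if "j < p" "y \<in> U" for j y
    using D(1)[OF that(1)] that(2) by (rule smooth_on_differentiable)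
  have h_cont: "continuous_on U (h j)" if "j < p" for j
    using D(2)[OF that] by (rule smooth_on_continuous)
  have T: "T > 0" using assms(4) by (simp add: T_periodic_solution_def)
  have X: "continuous_on U X" "Ck_on (Suc 0) X U"
    by (rule smooth_on_continuous[OF assms(2)], rule smooth_on_C1[OF assms(2)])
  have \<Gamma>_zero: "\<And>i y. i < k + p \<Longrightarrow> y \<in> \<Gamma> \<Longrightarrow> ?F i y = 0" and \<Gamma>_U: "\<Gamma> \<subseteq> U"
    using assms(6) by (auto simp: zero_fibre_def)
  have "continuous_on {0..T} \<gamma>"
    using assms(4) unfolding T_periodic_solution_def solution_on_def
    by (intro continuous_on_vector_derivative[where f' = "\<lambda>t. X (\<gamma> t)"])
      (auto intro: has_vector_derivative_at_within)
  then have \<Gamma>_compact: "compact \<Gamma>" "\<Gamma> \<noteq> {}" using T \<Gamma> by (auto intro: compact_continuous_image)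
  note \<Gamma>_facts = U \<Gamma>_compact \<Gamma>_U
  have F: "Ck_on (Suc 0) (?F i) U" if "i < k + p" for i
    using I(1)[of i] D(1)[of "i - k"] that by (cases "i < k") (auto simp: join_maps_def smooth_on_C1 simp del: Ck_on.simps)
  have orth: "v = 0" if y: "y \<in> \<Gamma>"
    and grad: "\<And>i. i < k + p \<Longrightarrow> gradient (?F i) y \<bullet> v = 0" and Xv: "X y \<bullet> v = 0" for y v
  proof -
    obtain t where t: "t \<in> {0..T}" "y = \<gamma> t" using y \<Gamma> by blast
    have gI: "gradient (I i) y \<bullet> v = 0" if "i < k" for i
      using grad[of i] that by (simp add: join_maps_def)
    have gD: "gradient (D j) y \<bullet> v = 0" if "j < p" for j
      using grad[of "k + j"] that by (simp add: join_maps_def)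
    show ?thesis
      using assms(8)[of t] t gI gD Xv kp
      by (intro eq_zero_of_orthogonal_independent_family[of
            "map (\<lambda>i. gradient (I i) (\<gamma> t)) [0..<k] @ map (\<lambda>j. gradient (D j) (\<gamma> t)) [0..<p] @ [X (\<gamma> t)]"])
         auto
  qed
  obtain L where L: "L > 0"
    "\<forall>\<^sub>F r in at_right 0. \<forall>y\<in>\<Gamma>. cball y r \<subseteq> U \<and> L-lipschitz_on (cball y r) X"
    by (rule C1_lipschitz_tube[OF \<Gamma>_facts X(2)])
  have tube: "orbit_tube U X T \<gamma> r L"
    if "r > 0" "\<forall>y\<in>\<Gamma>. cball y r \<subseteq> U \<and> L-lipschitz_on (cball y r) X" for r
  proof -
    have "\<gamma> t \<in> \<Gamma>" for t unfolding \<Gamma> by (rule periodic_orbit_mem[OF assms(4)])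
    then show ?thesis using that L(1) assms(4) X by unfold_locales auto
  qed
  have close: "\<forall>\<^sub>F r in at_right 0. \<forall>y\<in>\<Gamma>. \<forall>x\<in>cball y r. \<bar>h j x - h j y\<bar> \<le> \<eta>" if "j < p" "\<eta> > 0" for j \<eta>
    using C1_uniformly_close[OF \<Gamma>_facts] smooth_on_C1[OF D(2)] that by blast
  show ?thesis
  proof (intro conjI impI)
    assume "regular_value U k I (\<lambda>_. 0) \<and> (\<forall>j<p. ?m j < 0)"
    then have neg: "\<And>j. j < p \<Longrightarrow> ?m j < 0" by blast
    define V where "V x = (\<Sum>j<p. \<bar>D j x\<bar>)" for x
    have F_sum: "(\<Sum>i<k + p. \<bar>?F i x\<bar>) = V x" if "x \<in> zero_fibre U k I" for x
    proof -
      have "(\<Sum>i<k + n. \<bar>?F i x\<bar>) = (\<Sum>j<n. \<bar>D j x\<bar>)" for n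
        using that by (induction n) (auto simp: join_maps_def zero_fibre_def)
      then show ?thesis by (simp add: V_def)
    qed
    obtain c where c: "c > 0" "\<forall>\<^sub>F r in at_right 0. \<forall>y\<in>\<Gamma>. \<forall>x\<in>cball y r.
        (x - y) \<bullet> X y = 0 \<longrightarrow> c * norm (x - y) \<le> (\<Sum>i<k + p. \<bar>?F i x\<bar>)"
      using transversal_distance_estimate[of U \<Gamma> "k + p" ?F X] \<Gamma>_facts F X(1) \<Gamma>_zero orth by blast
    have "\<exists>C. 0 < C \<and> (\<forall>\<^sub>F r in at_right 0. \<forall>y\<in>\<Gamma>. cball y r \<subseteq> U \<and> C-lipschitz_on (cball y r) (D j))"
      if "j < p" for j
      by (rule C1_lipschitz_tube[OF \<Gamma>_facts smooth_on_C1[OF D(1)[OF that]]]) blast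
    then have "\<forall>j. \<exists>C. j < p \<longrightarrow> 0 < C \<and>
        (\<forall>\<^sub>F r in at_right 0. \<forall>y\<in>\<Gamma>. cball y r \<subseteq> U \<and> C-lipschitz_on (cball y r) (D j))"
      by blast
    from choice[OF this] obtain C where C: "\<And>j. j < p \<Longrightarrow> C j > 0"
      "\<And>j. j < p \<Longrightarrow> \<forall>\<^sub>F r in at_right 0. \<forall>y\<in>\<Gamma>. cball y r \<subseteq> U \<and> (C j)-lipschitz_on (cball y r) (D j)"
      by auto
    \<comment> \<open>This tolerance for \<open>h\<^sub>j\<close> uses up half of the decay exponent over a period, leaving the factor
      \<open>exp (?m j / 2) < 1\<close>.\<close>
    define \<eta> where "\<eta> j = - ?m j / (2 * T)" for j
    have \<eta>: "\<eta> j > 0" "?m j + \<eta> j * T = ?m j / 2" if "j < p" for j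
      using neg[OF that] T by (auto simp: \<eta>_def divide_neg_pos)
    have "\<forall>\<^sub>F r in at_right 0. \<forall>j\<in>{..<p}. \<forall>y\<in>\<Gamma>. cball y r \<subseteq> U \<and> (C j)-lipschitz_on (cball y r) (D j)"
      using C by (intro eventually_ball_finite) auto
    moreover have "\<forall>\<^sub>F r in at_right 0. \<forall>j\<in>{..<p}. \<forall>y\<in>\<Gamma>. \<forall>x\<in>cball y r. \<bar>h j x - h j y\<bar> \<le> \<eta> j"
      using close \<eta> by (intro eventually_ball_finite) auto
    ultimately have "\<forall>\<^sub>F r in at_right 0. 0 < r \<and>
        (\<forall>y\<in>\<Gamma>. cball y r \<subseteq> U \<and> L-lipschitz_on (cball y r) X) \<and>
        (\<forall>y\<in>\<Gamma>. \<forall>x\<in>cball y r. (x - y) \<bullet> X y = 0 \<longrightarrow> c * norm (x - y) \<le> (\<Sum>i<k + p. \<bar>?F i x\<bar>)) \<and>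
        (\<forall>j\<in>{..<p}. \<forall>y\<in>\<Gamma>. cball y r \<subseteq> U \<and> (C j)-lipschitz_on (cball y r) (D j)) \<and>
        (\<forall>j\<in>{..<p}. \<forall>y\<in>\<Gamma>. \<forall>x\<in>cball y r. \<bar>h j x - h j y\<bar> \<le> \<eta> j)"
      using L(2) c(2) by (intro eventually_conj eventually_at_right_less)
    from eventually_happens'[OF trivial_limit_at_right_real this] obtain r where r: "r > 0"
      "\<forall>y\<in>\<Gamma>. cball y r \<subseteq> U \<and> L-lipschitz_on (cball y r) X"
      "\<And>y x. y \<in> \<Gamma> \<Longrightarrow> x \<in> cball y r \<Longrightarrow> (x - y) \<bullet> X y = 0 \<Longrightarrow> c * norm (x - y) \<le> (\<Sum>i<k + p. \<bar>?F i x\<bar>)"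
      "\<And>j y. j < p \<Longrightarrow> y \<in> \<Gamma> \<Longrightarrow> (C j)-lipschitz_on (cball y r) (D j)"
      "\<And>j y x. j < p \<Longrightarrow> y \<in> \<Gamma> \<Longrightarrow> x \<in> cball y r \<Longrightarrow> \<bar>h j x - h j y\<bar> \<le> \<eta> j"
      by auto
    interpret orbit_tube U X T \<gamma> r L by (rule tube[OF r(1,2)])
    define q where "q = Max ((\<lambda>j. exp (?m j / 2)) ` {..<p})"
    have q_ge: "exp (?m j / 2) \<le> q" if "j < p" for j unfolding q_def using that by (intro Max_ge) auto
    have q_lt: "q < 1" unfolding q_def using kp neg by (subst Max_less_iff) auto
    have q_pos: "0 \<le> q" using q_ge[OF kp(1)] exp_ge_zero order_trans by blast
    have lower: "c * infdist x \<Gamma> \<le> V x" if x: "x \<in> zero_fibre U k I" "infdist x \<Gamma> \<le> r" for x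
    proof -
      obtain \<theta> where \<theta>: "\<theta> \<in> {0..T}" "infdist x \<Gamma> = dist x (\<gamma> \<theta>)" "(x - \<gamma> \<theta>) \<bullet> X (\<gamma> \<theta>) = 0"
        using nearest_phase[of x] unfolding \<Gamma> by blast
      then have "c * norm (x - \<gamma> \<theta>) \<le> (\<Sum>i<k + p. \<bar>?F i x\<bar>)"
        using x r(3)[of "\<gamma> \<theta>" x] orbit_mem[of \<theta>] unfolding \<Gamma> by (simp add: dist_commute)
      then show ?thesis using F_sum[OF x(1)] \<theta> by (simp add: dist_norm)
    qed
    have upper: "V x \<le> (\<Sum>j<p. C j) * infdist x \<Gamma>" if x: "infdist x \<Gamma> \<le> r" for x
    proof -
      obtain \<theta> where \<theta>: "infdist x \<Gamma> = dist x (\<gamma> \<theta>)"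
        using nearest_phase[of x] unfolding \<Gamma> by blast
      have \<theta>\<Gamma>: "\<gamma> \<theta> \<in> \<Gamma>" unfolding \<Gamma> by (rule orbit_mem)
      have "\<bar>D j x\<bar> \<le> C j * infdist x \<Gamma>" if j: "j < p" for j
      proof -
        have "dist (D j x) (D j (\<gamma> \<theta>)) \<le> C j * dist x (\<gamma> \<theta>)"
          using x r(1) \<theta> by (intro lipschitz_onD[OF r(4)[OF j \<theta>\<Gamma>]]) (auto simp: dist_commute)
        moreover have "D j (\<gamma> \<theta>) = 0" using \<Gamma>_zero[of "k + j", OF _ \<theta>\<Gamma>] j by (simp add: join_maps_def)
        ultimately show ?thesis using \<theta> by simp
      qed
      then show ?thesis unfolding V_def sum_distrib_right by (intro sum_mono) auto
    qed
    have contraction: "x (a + T) \<in> zero_fibre U k I \<and> V (x (a + T)) \<le> q * V (x a)"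
      if \<theta>: "\<theta> \<in> {0..T}" and sol: "solution_on U X {a..a + T} x" and xa: "x a \<in> zero_fibre U k I"
        and stay: "\<And>t. t \<in> {a..a + T} \<Longrightarrow> dist (x t) (\<gamma> (\<theta> + t - a)) \<le> r" for x a \<theta>
    proof
      have "x (a + T) \<in> U" using sol T by (simp add: solution_on_def)
      moreover have "I i (x (a + T)) = 0" if "i < k" for i
      proof (rule first_integral_zero[OF sol])
        show "I i differentiable (at y)" if "y \<in> U" for y
          using I(1)[OF \<open>i < k\<close>] that by (rule smooth_on_differentiable)
      qed (use T I(2) xa that in \<open>auto simp: zero_fibre_def\<close>)
      ultimately show "x (a + T) \<in> zero_fibre U k I" by (simp add: zero_fibre_def)
      have "\<bar>D j (x (a + T))\<bar> \<le> q * \<bar>D j (x a)\<bar>" if j: "j < p" for j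
      proof -
        have "\<bar>D j (x (a + T))\<bar> \<le> \<bar>D j (x a)\<bar> * exp (?m j + \<eta> j * T)"
        proof (rule multiplier_bounds(1)[OF D_diff[OF j] D(3)[OF j] h_cont[OF j] \<theta> sol])
          fix t assume "t \<in> {a..a + T}"
          then show "\<bar>h j (x t) - h j (\<gamma> (\<theta> + t - a))\<bar> \<le> \<eta> j"
            using stay r(5)[OF j, of "\<gamma> (\<theta> + t - a)" "x t"] orbit_mem unfolding \<Gamma>
            by (simp add: dist_commute)
        qed
        also have "\<dots> \<le> \<bar>D j (x a)\<bar> * q" unfolding \<eta>(2)[OF j] using q_ge[OF j] by (rule mult_left_mono) simp
        finally show ?thesis by (simp add: mult.commute)
      qed
      then show "V (x (a + T)) \<le> q * V (x a)" unfolding V_def sum_distrib_left by (intro sum_mono) auto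
    qed
    have C_sum: "(\<Sum>j<p. C j) \<ge> 0" using C(1) by (intro sum_nonneg) (auto intro: less_imp_le)
    show "orbitally_phase_asymptotically_stable U X (zero_fibre U k I) T \<gamma>"
    proof (rule phase_asymptotically_stable_of_contraction[OF c(1) _ C_sum _ _ q_pos q_lt])
      show "c * infdist x orbit \<le> V x" if "x \<in> zero_fibre U k I" "infdist x orbit \<le> r" for x
        using lower that unfolding \<Gamma> by blast
      show "V x \<le> (\<Sum>j<p. C j) * infdist x orbit" if "infdist x orbit \<le> r" for x
        using upper that unfolding \<Gamma> by blast
    qed (rule contraction)
  next
    assume "\<exists>j<p. ?m j > 0"
    then obtain j where j: "j < p" "?m j > 0" by blast
    define \<eta> where "\<eta> = ?m j / (2 * T)"
    have \<eta>: "\<eta> > 0" "?m j - \<eta> * T = ?m j / 2" using j T by (auto simp: \<eta>_def)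
    have "\<forall>\<^sub>F r in at_right 0. 0 < r \<and>
        (\<forall>y\<in>\<Gamma>. cball y r \<subseteq> U \<and> L-lipschitz_on (cball y r) X) \<and>
        (\<forall>y\<in>\<Gamma>. \<forall>x\<in>cball y r. \<bar>h j x - h j y\<bar> \<le> \<eta>) \<and>
        (\<forall>y\<in>\<Gamma>. \<forall>x\<in>cball y r. \<bar>D j x - D j y\<bar> \<le> 1)"
      using L(2) close[OF j(1) \<eta>(1)] C1_uniformly_close[OF \<Gamma>_facts smooth_on_C1[OF D(1)[OF j(1)]], of 1]
      by (intro eventually_conj eventually_at_right_less) auto
    from eventually_happens'[OF trivial_limit_at_right_real this] obtain r where r: "r > 0"
      "\<forall>y\<in>\<Gamma>. cball y r \<subseteq> U \<and> L-lipschitz_on (cball y r) X"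
      "\<And>y x. y \<in> \<Gamma> \<Longrightarrow> x \<in> cball y r \<Longrightarrow> \<bar>h j x - h j y\<bar> \<le> \<eta>"
      "\<And>y x. y \<in> \<Gamma> \<Longrightarrow> x \<in> cball y r \<Longrightarrow> \<bar>D j x - D j y\<bar> \<le> 1"
      by auto
    interpret orbit_tube U X T \<gamma> r L by (rule tube[OF r(1,2)])
    have mem: "\<gamma> t \<in> \<Gamma>" for t unfolding \<Gamma> by (rule orbit_mem)
    have D_zero: "D j (\<gamma> t) = 0" for t using \<Gamma>_zero[of "k + j", OF _ mem] j by (simp add: join_maps_def)
    have "orbitally_unstable U X orbit"
    proof (rule unstable_of_expansion[where V = "\<lambda>x. \<bar>D j x\<bar>" and q = "exp (?m j / 2)" and C = 1])
      fix x a \<theta> assume \<theta>: "\<theta> \<in> {0..T}" and sol: "solution_on U X {a..a + T} x"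
        and stay: "\<And>t. t \<in> {a..a + T} \<Longrightarrow> dist (x t) (\<gamma> (\<theta> + t - a)) \<le> r"
      have "\<bar>D j (x a)\<bar> * exp (?m j - \<eta> * T) \<le> \<bar>D j (x (a + T))\<bar>"
      proof (rule multiplier_bounds(2)[OF D_diff[OF j(1)] D(3)[OF j(1)] h_cont[OF j(1)] \<theta> sol])
        fix t assume "t \<in> {a..a + T}"
        then show "\<bar>h j (x t) - h j (\<gamma> (\<theta> + t - a))\<bar> \<le> \<eta>"
          using stay r(3)[OF mem, of "x t" "\<theta> + t - a"] by (simp add: dist_commute)
      qed
      then show "exp (?m j / 2) * \<bar>D j (x a)\<bar> \<le> \<bar>D j (x (a + T))\<bar>"
        unfolding \<eta>(2) by (simp add: mult.commute)
    next
      fix x assume x: "infdist x orbit \<le> r"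
      obtain \<theta> where "infdist x orbit = dist x (\<gamma> \<theta>)" using nearest_phase by metis
      then show "\<bar>D j x\<bar> \<le> 1" using r(4)[OF mem, of x \<theta>] x D_zero by (simp add: dist_commute)
    next
      have "gradient (D j) (\<gamma> 0) \<noteq> 0"
      proof
        assume "gradient (D j) (\<gamma> 0) = 0"
        then have "0 \<in> set (map (\<lambda>i. gradient (I i) (\<gamma> 0)) [0..<k] @
              map (\<lambda>j. gradient (D j) (\<gamma> 0)) [0..<p] @ [X (\<gamma> 0)])" using j by force
        moreover have "independent (set (map (\<lambda>i. gradient (I i) (\<gamma> 0)) [0..<k] @
              map (\<lambda>j. gradient (D j) (\<gamma> 0)) [0..<p] @ [X (\<gamma> 0)]))"
          using assms(8)[of 0] T unfolding independent_family_def by simp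
        ultimately show False using dependent_zero by blast
      qed
      then show "\<exists>x\<in>U. infdist x orbit < \<delta> \<and> \<bar>D j x\<bar> > 0" if "\<delta> > 0" for \<delta>
        using exists_point_off_zero_set[OF U D_diff[OF j(1)] D_zero _ that] mem \<Gamma>_U by blast
    qed (use j in auto)
    then show "orbitally_unstable U X \<Gamma>" by (simp add: \<Gamma>)
  qed
qed

end
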